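(* Let $(\Sigma,\sigma)$ be a transitive countable Markov shift. Then the set of measures in $\mathcal{M}(\Sigma,\sigma)$ that are not equilibrium measures for any bounded above continuous function $\phi:\Sigma\to\mathbb{R}$ is dense in $\mathcal{M}(\Sigma,\sigma)$ with respect to the weak$^*$ topology.
   Context: Countable Markov shift: let $M$ be an $\mathbb{N}\times\mathbb{N}$ matrix with entries in $\{0,1\}$, $\mathbb{N}=\{1,2,\dots\}$; $\Sigma=\{(x_1,x_2,\dots)\in\mathbb{N}^{\mathbb{N}}: M(x_i,x_{i+1})=1\ \forall i\in\mathbb{N}\}$ with the topology induced by the product of discrete topologies, and $\sigma(x_1,x_2,\dots)=(x_2,x_3,\dots)$. An admissible word is a finite string $a_1\dots a_N$ in $\mathbb{N}$ with $M(a_i,a_{i+1})=1$ for $1\le i<N$. The shift is transitive if for all $a,b\in\mathbb{N}$ there is an admissible word starting with $a$ and ending with $b$ (in particular $\Sigma$ is non-compact). $\mathcal{M}(\Sigma,\sigma)$ is the set of $\sigma$-invariant Borel probability measures on $\Sigma$ with the weak$^*$ topology: $\mu_n\to\mu$ iff $\int f\,d\mu_n\to\int f\,d\mu$ for every bounded continuous $f:\Sigma\to\mathbb{R}$. $h(\nu)$ is the measure-theoretic entropy of $\nu$. For continuous $\phi:\Sigma\to\mathbb{R}$, $P(\phi)=\sup\{h(\nu)+\int\phi\,d\nu:\nu\in\mathcal{M}(\Sigma,\sigma),\ \int\phi\,d\nu>-\infty\}$; a measure $\nu\in\mathcal{M}(\Sigma,\sigma)$ with $\int\phi\,d\nu>-\infty$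 attaining this supremum is an equilibrium measure for $\phi$. *)

theory Defs
  imports "HOL-Probability.Probability"
begin

section \<open>Countable Markov shifts\<close>

text \<open>
  The alphabet is the whole type \<^typ>\<open>nat\<close>, and sequences are indexed from 0; this only relabels
  the letters and positions 1, 2, 3, \dots.  The topology on \<^typ>\<open>nat \<Rightarrow> nat\<close> is the library's
  product topology, and a shift space carries the subspace topology.
\<close>

definition transition_matrix :: "(nat \<Rightarrow> nat \<Rightarrow> nat) \<Rightarrow> bool" where
  "transition_matrix M \<longleftrightarrow> (\<forall>a b. M a b \<in> {0, 1})"

definition shift_space :: "(nat \<Rightarrow> nat \<Rightarrow> nat) \<Rightarrow> (nat \<Rightarrow> nat) set" where
  "shift_space M = {x. \<forall>i. M (x i) (x (Suc i)) = 1}"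

definition shift :: "(nat \<Rightarrow> nat) \<Rightarrow> (nat \<Rightarrow> nat)" where
  "shift x = (\<lambda>i. x (Suc i))"

definition admissible_word :: "(nat \<Rightarrow> nat \<Rightarrow> nat) \<Rightarrow> nat list \<Rightarrow> bool" where
  "admissible_word M w \<longleftrightarrow> (\<forall>i. Suc i < length w \<longrightarrow> M (w ! i) (w ! Suc i) = 1)"

definition transitive_shift :: "(nat \<Rightarrow> nat \<Rightarrow> nat) \<Rightarrow> bool" where
  "transitive_shift M \<longleftrightarrow>
     (\<forall>a b. \<exists>w. w \<noteq> [] \<and> admissible_word M w \<and> hd w = a \<and> last w = b)"

section \<open>Invariant measures and the weak* topology\<close>

definition invariant_measures :: "(nat \<Rightarrow> nat \<Rightarrow> nat) \<Rightarrow> (nat \<Rightarrow> nat) measure set" where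
  "invariant_measures M =
     {\<mu>. prob_space \<mu> \<and> sets \<mu> = sets (restrict_space borel (shift_space M)) \<and>
         distr \<mu> \<mu> shift = \<mu>}"

text \<open>The coarsest topology making \<open>\<mu> \<mapsto> \<integral>f d\<mu>\<close> continuous for every bounded continuous \<open>f\<close>.\<close>

definition weak_star_topology :: "(nat \<Rightarrow> nat \<Rightarrow> nat) \<Rightarrow> (nat \<Rightarrow> nat) measure topology" where
  "weak_star_topology M = topology_generated_by
     {{\<mu> \<in> invariant_measures M. (\<integral>x. f x \<partial>\<mu>) \<in> U} | (f :: (nat \<Rightarrow> nat) \<Rightarrow> real) U.
        continuous_on (shift_space M) f \<and> bounded (f ` shift_space M) \<and> open U}"

section \<open>Measure-theoretic entropy\<close>

definition partition_entropy :: "'a measure \<Rightarrow> 'a set set \<Rightarrow> real" where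
  "partition_entropy \<mu> \<alpha> = - (\<Sum>A\<in>\<alpha>. measure \<mu> A * ln (measure \<mu> A))"

text \<open>
  The join of the preimages of \<open>\<alpha>\<close> under \<open>T ^^ i\<close> for \<open>i < n\<close>.  Some of these preimages may be
  empty; \<^const>\<open>common_refinement\<close> discards empty cells.
\<close>

definition iterated_join :: "'a measure \<Rightarrow> ('a \<Rightarrow> 'a) \<Rightarrow> 'a set set \<Rightarrow> nat \<Rightarrow> 'a set set" where
  "iterated_join \<mu> T \<alpha> n =
     common_refinement ((\<lambda>i. (\<lambda>A. (T ^^ i) -` A \<inter> space \<mu>) ` \<alpha>) ` {..<n})"

definition entropy_wrt_partition :: "'a measure \<Rightarrow> ('a \<Rightarrow> 'a) \<Rightarrow> 'a set set \<Rightarrow> real" where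
  "entropy_wrt_partition \<mu> T \<alpha> =
     lim (\<lambda>n. partition_entropy \<mu> (iterated_join \<mu> T \<alpha> n) / real n)"

definition measure_entropy :: "'a measure \<Rightarrow> ('a \<Rightarrow> 'a) \<Rightarrow> ereal" where
  "measure_entropy \<mu> T =
     (SUP \<alpha> \<in> {\<alpha>. finite \<alpha> \<and> partition_on (space \<mu>) \<alpha> \<and> \<alpha> \<subseteq> sets \<mu>}.
        ereal (entropy_wrt_partition \<mu> T \<alpha>))"

section \<open>Pressure and equilibrium measures\<close>

text \<open>
  The Bochner integral is 0 on non-integrable functions, so the integral with values in
  \<open>[-\<infinity>, \<infinity>]\<close> is built from the positive and negative parts.  If both parts diverge the value
  is set to \<open>-\<infinity>\<close>, so that the measure is excluded from the pressure; for \<open>\<phi>\<close> bounded above and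
  \<open>\<mu>\<close> finite this never occurs.
\<close>

definition extended_integral :: "'a measure \<Rightarrow> ('a \<Rightarrow> real) \<Rightarrow> ereal" where
  "extended_integral \<mu> \<phi> =
     (if (\<integral>\<^sup>+x. ennreal (- \<phi> x) \<partial>\<mu>) = \<infinity> then - \<infinity>
      else enn2ereal (\<integral>\<^sup>+x. ennreal (\<phi> x) \<partial>\<mu>) - enn2ereal (\<integral>\<^sup>+x. ennreal (- \<phi> x) \<partial>\<mu>))"

definition pressure :: "(nat \<Rightarrow> nat \<Rightarrow> nat) \<Rightarrow> ((nat \<Rightarrow> nat) \<Rightarrow> real) \<Rightarrow> ereal" where
  "pressure M \<phi> =
     (SUP \<nu> \<in> {\<nu> \<in> invariant_measures M. extended_integral \<nu> \<phi> > - \<infinity>}.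
        measure_entropy \<nu> shift + extended_integral \<nu> \<phi>)"

text \<open>The supremum may be \<open>\<infinity>\<close>, in which case it is attained by a measure of infinite free energy.\<close>

definition equilibrium_measure ::
  "(nat \<Rightarrow> nat \<Rightarrow> nat) \<Rightarrow> ((nat \<Rightarrow> nat) \<Rightarrow> real) \<Rightarrow> (nat \<Rightarrow> nat) measure \<Rightarrow> bool" where
  "equilibrium_measure M \<phi> \<nu> \<longleftrightarrow>
     \<nu> \<in> invariant_measures M \<and> extended_integral \<nu> \<phi> > - \<infinity> \<and>
     measure_entropy \<nu> shift + extended_integral \<nu> \<phi> = pressure M \<phi>"

end

theory Submission
  imports Defs
begin

text \<open>
  Mixing an invariant measure with a suitable auxiliary measure \<open>q\<close> destroys the equilibrium
  property for every potential at once.  By transitivity some letter lies on two distinct loops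
  of equal length, whose concatenations are coded by a tower of constant height over the full
  2-shift.
  Let \<open>\<nu>\<close> be the tower measure over the fair Bernoulli measure and \<open>\<rho> n\<close> the tower measure over the
  uniform distribution on the \<open>n\<close>-periodic bit sequences.  Then \<open>h(\<nu>) > 0\<close>, and each
  \<open>\<rho> n\<close> is supported on finitely many periodic points.  Let \<open>q\<close> be a mixture of all \<open>\<rho> n\<close> with
  positive weights.

  Suppose that \<open>m = \<epsilon> q + (1 - \<epsilon>) p\<close>, with \<open>p\<close> invariant and countably supported, is an
  equilibrium measure for \<open>\<phi>\<close>.  Countably supported measures have entropy zero, so
  the pressure is the finite number \<open>\<integral>\<phi> dm\<close>.  Each component of \<open>m\<close> is an invariant measure of
  entropy zero, hence its integral is at most the pressure; as their weighted average is
  the pressure itself, \<open>\<integral>\<phi> d\<rho> n\<close> equals the pressure for every \<open>n\<close>.  Periodizing random bits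
  and applying Fatou's lemma to \<open>C - \<phi>\<close>, where \<open>C\<close> is an upper bound of \<open>\<phi>\<close>, it follows that
  \<open>\<integral>\<phi> d\<nu>\<close> is at least the pressure, so that \<open>h(\<nu>) + \<integral>\<phi> d\<nu>\<close> exceeds it: a contradiction
  (\<open>atomic_mixture_not_equilibrium\<close>).

  It remains to see that countably supported invariant measures are weak* dense; then let \<open>\<epsilon>\<close>
  tend to 0.  This step cannot be skipped, because a measure of infinite entropy is an
  equilibrium measure for \<open>\<phi> = 0\<close>.  Given an invariant \<open>\<mu>\<close> and \<open>N > 0\<close>, the joint law of
  the blocks of length \<open>N\<close> of \<open>x\<close> and of the shifted point is a probability distribution on
  the edges of a countable graph with equal in-flow and out-flow at each vertex.  Such a
  distribution is a countable mixture of uniform distributions on closed walks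
  (\<open>balanced_pmf_cycle_decomposition\<close>), and closed walks are periodic points.  The
  corresponding mixture of periodic orbits has exactly the same law of \<open>N\<close>-blocks as \<open>\<mu>\<close>, and
  agreement of block laws of growing length implies weak* convergence.
\<close>

section \<open>Balanced distributions on graphs are mixtures of cycles\<close>

text \<open>
  From a nonnegative function \<open>f\<close> one subtracts in turn the largest admissible multiple of each
  finitely supported distribution \<open>K i\<close>.  Afterwards every \<open>K i\<close> charges a point at which
  nothing of \<open>f\<close> is left.
\<close>

lemma greedy_subtraction:
  fixes f :: "'a \<Rightarrow> real" and K :: "nat \<Rightarrow> 'a pmf"
  assumes f: "\<And>e. 0 \<le> f e" and K: "\<And>i. finite (set_pmf (K i))"
  obtains c :: "nat \<Rightarrow> real" where "\<And>i. 0 \<le> c i"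
    and "\<And>e. summable (\<lambda>i. c i * pmf (K i) e)"
    and "\<And>e. (\<Sum>i. c i * pmf (K i) e) \<le> f e"
    and "\<And>i. \<exists>e\<in>set_pmf (K i). (\<Sum>j. c j * pmf (K j) e) = f e"
proof -
  \<comment> \<open>\<open>a r n\<close> is the largest multiple of \<open>K n\<close> that fits below \<open>r\<close>; \<open>r n\<close> is what is left after \<open>n\<close> steps.\<close>
  define a where "a r n = Min ((\<lambda>e. r e / pmf (K n) e) ` set_pmf (K n))" for r n
  define r where "r = rec_nat f (\<lambda>n r e. r e - a r n * pmf (K n) e)"
  define c where "c n = a (r n) n" for n
  have r0: "r 0 = f" and rS: "r (Suc n) = (\<lambda>e. r n e - c n * pmf (K n) e)" for n
    by (simp_all add: r_def c_def)
  have fin: "finite ((\<lambda>e. r n e / pmf (K n) e) ` set_pmf (K n))"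
    and ne: "(\<lambda>e. r n e / pmf (K n) e) ` set_pmf (K n) \<noteq> {}" for n
    using K by (auto simp: set_pmf_not_empty)
  have le: "c n * pmf (K n) e \<le> r n e" if "e \<in> set_pmf (K n)" for n e
  proof -
    have "c n \<le> r n e / pmf (K n) e"
      unfolding c_def a_def using fin that by (intro Min_le) auto
    thus ?thesis using that by (simp add: field_simps pmf_positive)
  qed
  have r_nonneg: "0 \<le> r n e" for n e
  proof (induction n arbitrary: e)
    case 0 thus ?case by (simp add: r0 f)
  next
    case (Suc n) thus ?case using le[of e n]
      by (cases "e \<in> set_pmf (K n)") (auto simp: rS set_pmf_eq)
  qed
  have c_nonneg: "0 \<le> c n" for n
    unfolding c_def a_def using fin ne r_nonneg by (subst Min_ge_iff) auto
  have partial: "(\<Sum>i<n. c i * pmf (K i) e) = f e - r n e" for n e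
    by (induction n) (auto simp: r0 rS)
  have summ: "summable (\<lambda>i. c i * pmf (K i) e)" for e
    using r_nonneg partial by (intro summableI_nonneg_bounded[where x="f e"]) (auto simp: c_nonneg)
  have bound: "(\<Sum>i. c i * pmf (K i) e) \<le> f e" for e
    using r_nonneg partial by (intro suminf_le_const summ) auto
  have "\<exists>e\<in>set_pmf (K i). (\<Sum>j. c j * pmf (K j) e) = f e" for i
  proof -
    have "c i \<in> (\<lambda>e. r i e / pmf (K i) e) ` set_pmf (K i)"
      unfolding c_def a_def using fin ne by (rule Min_in)
    then obtain e where e: "e \<in> set_pmf (K i)" "c i = r i e / pmf (K i) e" by auto
    hence "r (Suc i) e = 0" by (simp add: rS set_pmf_eq)
    hence "(\<Sum>j<Suc i. c j * pmf (K j) e) = f e" by (simp only: partial)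
    moreover have "(\<Sum>j<Suc i. c j * pmf (K j) e) \<le> (\<Sum>j. c j * pmf (K j) e)"
      by (intro sum_le_suminf summ) (auto simp: c_nonneg)
    ultimately show ?thesis using e(1) bound[of e] by (intro bexI[of _ e]) auto
  qed
  thus thesis using that c_nonneg summ bound by blast
qed

text \<open>
  In a balanced flow of finite total mass, every edge with positive flow lies on a cycle of such
  edges.  Otherwise the set \<open>R\<close> of vertices reachable from the head of \<open>(a, b)\<close> would receive
  more flow than leaves its vertices: all flow out of \<open>R\<close> stays in \<open>R\<close>, while \<open>(a, b)\<close> enters \<open>R\<close>
  from outside.
\<close>

lemma balanced_flow_edge_on_cycle:
  fixes r :: "'v \<times> 'v \<Rightarrow> ennreal"
  assumes fin: "(\<integral>\<^sup>+e. r e \<partial>count_space UNIV) < \<infinity>"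
    and bal: "\<And>u. (\<integral>\<^sup>+v. r (u, v) \<partial>count_space UNIV) = (\<integral>\<^sup>+v. r (v, u) \<partial>count_space UNIV)"
    and pos: "0 < r (a, b)"
  shows "(b, a) \<in> {e. 0 < r e}\<^sup>*"
proof (rule ccontr)
  assume na: "(b, a) \<notin> {e. 0 < r e}\<^sup>*"
  define R where "R = {v. (b, v) \<in> {e. 0 < r e}\<^sup>*}"
  have bR: "b \<in> R" and aR: "a \<notin> R" using na by (auto simp: R_def)
  have step: "v \<in> R" if "u \<in> R" "0 < r (u, v)" for u v
    using that unfolding R_def by (auto intro: rtrancl_into_rtrancl)
  define S1 where "S1 = (\<integral>\<^sup>+e. indicator R (fst e) * r e \<partial>count_space UNIV)"
  define S2 where "S2 = (\<integral>\<^sup>+e. indicator R (snd e) * r e \<partial>count_space UNIV)"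
  have "S1 = (\<integral>\<^sup>+u. \<integral>\<^sup>+v. indicator R u * r (u, v) \<partial>count_space UNIV \<partial>count_space UNIV)"
    unfolding S1_def by (subst nn_integral_fst_count_space[symmetric]) simp
  also have "\<dots> = (\<integral>\<^sup>+u. indicator R u * (\<integral>\<^sup>+v. r (u, v) \<partial>count_space UNIV) \<partial>count_space UNIV)"
    by (simp add: nn_integral_cmult)
  also have "\<dots> = (\<integral>\<^sup>+u. \<integral>\<^sup>+v. indicator R u * r (v, u) \<partial>count_space UNIV \<partial>count_space UNIV)"
    by (simp add: nn_integral_cmult bal)
  also have "\<dots> = S2"
    unfolding S2_def by (subst nn_integral_snd_count_space[symmetric]) simp
  finally have S12: "S1 = S2" .
  have "S1 + r (a, b) = (\<integral>\<^sup>+e. indicator R (fst e) * r e + r (a, b) * indicator {(a, b)} e \<partial>count_space UNIV)"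
    unfolding S1_def by (subst nn_integral_add) (auto simp: nn_integral_cmult_indicator)
  also have "\<dots> \<le> S2"
    unfolding S2_def
  proof (rule nn_integral_mono)
    fix e :: "'v \<times> 'v"
    obtain u v where e: "e = (u, v)" by (cases e)
    have "r (u, v) = 0" if "u \<in> R" "v \<notin> R" using step[of u v] that by (auto simp: zero_less_iff_neq_zero)
    thus "indicator R (fst e) * r e + r (a, b) * indicator {(a, b)} e \<le> indicator R (snd e) * r e"
      using aR bR by (auto simp: e indicator_def)
  qed
  finally have "S1 + r (a, b) \<le> S1 + 0" by (simp add: S12)
  moreover have "S1 \<le> (\<integral>\<^sup>+e. r e \<partial>count_space UNIV)"
    unfolding S1_def by (intro nn_integral_mono) (auto simp: indicator_def)
  ultimately show False using pos fin
    unfolding ennreal_add_left_cancel_le by (auto simp: top_unique)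
qed

text \<open>
  The uniform distribution on the edges (with multiplicity) of the closed walk through the
  vertices \<open>xs\<close>, whose last vertex is joined to the first one.
\<close>
definition closed_walk_pmf :: "'v list \<Rightarrow> ('v \<times> 'v) pmf" where
  "closed_walk_pmf xs =
     map_pmf (\<lambda>j. (xs ! j, xs ! (Suc j mod length xs))) (pmf_of_set {..<length xs})"

lemma map_pmf_rotate:
  assumes "0 < n"
  shows "map_pmf (\<lambda>j. Suc j mod n) (pmf_of_set {..<n}) = pmf_of_set {..<n}"
proof (rule map_pmf_of_set_bij_betw)
  have "inj_on (\<lambda>j. Suc j mod n) {..<n}"
    by (auto simp: inj_on_def mod_Suc split: if_splits)
  moreover have "(\<lambda>j. Suc j mod n) ` {..<n} \<subseteq> {..<n}" using assms by auto
  ultimately show "bij_betw (\<lambda>j. Suc j mod n) {..<n} {..<n}"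
    by (simp add: bij_betw_def endo_inj_surj)
qed (use assms in auto)

lemma closed_walk_pmf_balanced:
  assumes "xs \<noteq> []"
  shows "map_pmf fst (closed_walk_pmf xs) = map_pmf snd (closed_walk_pmf xs)"
proof -
  have "map_pmf snd (closed_walk_pmf xs) =
    map_pmf (\<lambda>j. xs ! j) (map_pmf (\<lambda>j. Suc j mod length xs) (pmf_of_set {..<length xs}))"
    by (simp add: closed_walk_pmf_def map_pmf_comp)
  also have "\<dots> = map_pmf fst (closed_walk_pmf xs)"
    using assms by (simp add: map_pmf_rotate closed_walk_pmf_def map_pmf_comp)
  finally show ?thesis ..
qed

lemma set_closed_walk_pmf:
  assumes "xs \<noteq> []"
  shows "set_pmf (closed_walk_pmf xs) = (\<lambda>j. (xs ! j, xs ! (Suc j mod length xs))) ` {..<length xs}"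
  using assms by (subst closed_walk_pmf_def) (simp add: set_map_pmf lessThan_empty_iff)

lemma nn_integral_pmf_Pair:
  fixes E :: "('a \<times> 'b) pmf"
  shows "(\<integral>\<^sup>+v. ennreal (pmf E (u, v)) \<partial>count_space UNIV) = ennreal (pmf (map_pmf fst E) u)"
  and "(\<integral>\<^sup>+v. ennreal (pmf E (v, w)) \<partial>count_space UNIV) = ennreal (pmf (map_pmf snd E) w)"
proof -
  have "range (Pair (u :: 'a)) = (fst -` {u} :: ('a \<times> 'b) set)" for u by auto
  moreover have "range (\<lambda>v. (v, u :: 'b)) = (snd -` {u} :: ('a \<times> 'b) set)" for u by auto
  ultimately show "(\<integral>\<^sup>+v. ennreal (pmf E (u, v)) \<partial>count_space UNIV) = ennreal (pmf (map_pmf fst E) u)"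
    "(\<integral>\<^sup>+v. ennreal (pmf E (v, w)) \<partial>count_space UNIV) = ennreal (pmf (map_pmf snd E) w)"
    by (simp_all add: nn_integral_pmf' inj_on_def ennreal_pmf_map)
qed

lemma rtrancl_walk:
  assumes "(b, a) \<in> S\<^sup>*"
  obtains xs where "xs \<noteq> []" "hd xs = b" "last xs = a"
    "\<And>j. Suc j < length xs \<Longrightarrow> (xs ! j, xs ! Suc j) \<in> S"
  using assms
proof (induction arbitrary: thesis rule: rtrancl_induct)
  case base
  show ?case by (rule base[of "[b]"]) auto
next
  case (step y z)
  obtain xs where xs: "xs \<noteq> []" "hd xs = b" "last xs = y"
    "\<And>j. Suc j < length xs \<Longrightarrow> (xs ! j, xs ! Suc j) \<in> S" using step.IH by blast
  show ?case
  proof (rule step.prems[of "xs @ [z]"])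
    fix j assume j: "Suc j < length (xs @ [z])"
    show "((xs @ [z]) ! j, (xs @ [z]) ! Suc j) \<in> S"
    proof (cases "Suc j < length xs")
      case True thus ?thesis using xs(4)[of j] by (simp add: nth_append)
    next
      case False
      hence "j = length xs - 1" "Suc j = length xs" using j by auto
      thus ?thesis using xs(1,3) step.hyps(2) by (simp add: nth_append last_conv_nth)
    qed
  qed (use xs in auto)
qed

text \<open>
  The closed walks form a countable family, so they can be subtracted greedily.  The remainder is
  again balanced; if it were nonzero, a closed walk through positive edges would remain,
  although each closed walk was exhausted.
\<close>

theorem balanced_pmf_cycle_decomposition:
  fixes E :: "('v :: countable \<times> 'v) pmf"
  assumes bal: "map_pmf fst E = map_pmf snd E"
  obtains C :: "'v list pmf" where "[] \<notin> set_pmf C" and "E = bind_pmf C closed_walk_pmf"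
proof -
  \<comment> \<open>An enumeration of all nonempty lists; the empty list is replaced by a dummy.\<close>
  define ys :: "nat \<Rightarrow> 'v list" where "ys i = (if from_nat i = ([] :: 'v list) then [undefined] else from_nat i)" for i
  define K where "K i = closed_walk_pmf (ys i)" for i
  have ys: "ys i \<noteq> []" for i by (simp add: ys_def)
  have finK: "finite (set_pmf (K i))" for i by (simp add: K_def set_closed_walk_pmf ys)
  obtain c where c: "\<And>i. 0 \<le> c i" "\<And>e. summable (\<lambda>i. c i * pmf (K i) e)"
    "\<And>e. (\<Sum>i. c i * pmf (K i) e) \<le> pmf E e"
    "\<And>i. \<exists>e\<in>set_pmf (K i). (\<Sum>j. c j * pmf (K j) e) = pmf E e"
    by (rule greedy_subtraction[of "pmf E" K, OF pmf_nonneg finK]) blast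
  define g where "g e = (\<Sum>j. c j * pmf (K j) e)" for e
  define r where "r e = ennreal (pmf E e - g e)" for e
  have g_nonneg: "0 \<le> g e" for e unfolding g_def by (intro suminf_nonneg c) (simp add: c)
  have Er: "ennreal (pmf E e) = ennreal (g e) + r e" for e
    using c(3)[of e] g_nonneg[of e] by (simp add: r_def g_def[symmetric] ennreal_plus[symmetric] del: ennreal_plus)
  have g_enn: "ennreal (g e) = (\<integral>\<^sup>+i. ennreal (c i) * ennreal (pmf (K i) e) \<partial>count_space UNIV)" for e
    unfolding g_def nn_integral_count_space_nat ennreal_mult'[symmetric, OF c(1)]
    by (intro suminf_ennreal2[symmetric] c) (simp add: c)
  have g_out: "(\<integral>\<^sup>+v. ennreal (g (u, v)) \<partial>count_space UNIV)
       = (\<integral>\<^sup>+i. ennreal (c i) * ennreal (pmf (map_pmf fst (K i)) u) \<partial>count_space UNIV)"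
   and g_in: "(\<integral>\<^sup>+v. ennreal (g (v, u)) \<partial>count_space UNIV)
       = (\<integral>\<^sup>+i. ennreal (c i) * ennreal (pmf (map_pmf snd (K i)) u) \<partial>count_space UNIV)" for u
    unfolding g_enn
    by (subst pair_sigma_finite.Fubini'; simp add: nn_integral_cmult nn_integral_pmf_Pair pair_sigma_finite_def sigma_finite_measure_count_space)+
  have g_bal: "(\<integral>\<^sup>+v. ennreal (g (u, v)) \<partial>count_space UNIV) = (\<integral>\<^sup>+v. ennreal (g (v, u)) \<partial>count_space UNIV)" for u
    unfolding g_out g_in by (simp add: K_def closed_walk_pmf_balanced ys)
  have E_bal: "(\<integral>\<^sup>+v. ennreal (pmf E (u, v)) \<partial>count_space UNIV) = (\<integral>\<^sup>+v. ennreal (pmf E (v, u)) \<partial>count_space UNIV)" for u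
    by (simp add: nn_integral_pmf_Pair bal)
  have r_bal: "(\<integral>\<^sup>+v. r (u, v) \<partial>count_space UNIV) = (\<integral>\<^sup>+v. r (v, u) \<partial>count_space UNIV)" for u
  proof -
    have "(\<integral>\<^sup>+v. ennreal (g (u, v)) \<partial>count_space UNIV) + (\<integral>\<^sup>+v. r (u, v) \<partial>count_space UNIV) =
      (\<integral>\<^sup>+v. ennreal (g (u, v)) \<partial>count_space UNIV) + (\<integral>\<^sup>+v. r (v, u) \<partial>count_space UNIV)"
      using E_bal[of u] unfolding Er by (simp add: nn_integral_add g_bal)
    moreover have "(\<integral>\<^sup>+v. ennreal (g (u, v)) \<partial>count_space UNIV) \<noteq> \<infinity>"
    proof -
      have "(\<integral>\<^sup>+v. ennreal (g (u, v)) \<partial>count_space UNIV) \<le> (\<integral>\<^sup>+v. ennreal (pmf E (u, v)) \<partial>count_space UNIV)"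
        by (intro nn_integral_mono) (simp add: Er)
      thus ?thesis by (auto simp: nn_integral_pmf_Pair top_unique)
    qed
    ultimately show ?thesis by (simp add: ennreal_add_left_cancel)
  qed
  have tot: "(\<integral>\<^sup>+e. ennreal (pmf E e) \<partial>count_space UNIV) = 1"
    by (simp add: nn_integral_pmf measure_pmf.emeasure_space_1[simplified])
  have "r e \<le> ennreal (pmf E e)" for e by (simp add: Er)
  hence "(\<integral>\<^sup>+e. r e \<partial>count_space UNIV) \<le> (\<integral>\<^sup>+e. ennreal (pmf E e) \<partial>count_space UNIV)"
    by (intro nn_integral_mono) auto
  hence r_fin: "(\<integral>\<^sup>+e. r e \<partial>count_space UNIV) < \<infinity>" unfolding tot
    by (metis ennreal_one_less_top infinity_ennreal_def order_le_less_trans)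
  have r0: "r e = 0" for e
  proof (rule ccontr)
    obtain a b where e: "e = (a, b)" by (cases e)
    assume "r e \<noteq> 0"
    hence pos: "0 < r (a, b)" by (simp add: e zero_less_iff_neq_zero)
    obtain xs where xs: "xs \<noteq> []" "hd xs = b" "last xs = a"
      "\<And>j. Suc j < length xs \<Longrightarrow> (xs ! j, xs ! Suc j) \<in> {e. 0 < r e}"
      using rtrancl_walk[OF balanced_flow_edge_on_cycle[OF r_fin r_bal pos]] by blast
    obtain i where i: "ys i = xs"
      using xs(1) by (metis from_nat_to_nat ys_def)
    obtain e' where e': "e' \<in> set_pmf (K i)" "g e' = pmf E e'" using c(4)[of i] by (auto simp: g_def)
    then obtain j where j: "j < length xs" "e' = (xs ! j, xs ! (Suc j mod length xs))"
      by (auto simp: K_def i set_closed_walk_pmf xs(1))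
    have "0 < r e'"
    proof (cases "Suc j < length xs")
      case True thus ?thesis using xs(4) j by auto
    next
      case False
      hence "j = length xs - 1" "Suc j = length xs" using j(1) by auto
      thus ?thesis using pos xs(1-3) by (simp add: j(2) last_conv_nth hd_conv_nth)
    qed
    thus False by (simp add: r_def e'(2))
  qed
  have Eg: "ennreal (pmf E e) = (\<integral>\<^sup>+i. ennreal (c i) * ennreal (pmf (K i) e) \<partial>count_space UNIV)" for e
    by (simp add: Er r0 g_enn)
  have "1 = (\<integral>\<^sup>+e. \<integral>\<^sup>+i. ennreal (c i) * ennreal (pmf (K i) e) \<partial>count_space UNIV \<partial>count_space UNIV)"
    unfolding Eg[symmetric] tot ..
  also have "\<dots> = (\<integral>\<^sup>+i. ennreal (c i) \<partial>count_space UNIV)"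
    by (subst pair_sigma_finite.Fubini')
       (simp_all add: nn_integral_cmult nn_integral_pmf pair_sigma_finite_def
          sigma_finite_measure_count_space measure_pmf.emeasure_space_1[simplified])
  finally have c1: "(\<integral>\<^sup>+i. ennreal (c i) \<partial>count_space UNIV) = 1" ..
  define D where "D = embed_pmf c"
  have D: "pmf D i = c i" for i unfolding D_def using c(1) c1 by (rule pmf_embed_pmf)
  show thesis
  proof (rule that[of "map_pmf ys D"])
    show "[] \<notin> set_pmf (map_pmf ys D)" using ys by (metis imageE set_map_pmf)
    show "E = bind_pmf (map_pmf ys D) closed_walk_pmf"
    proof (rule pmf_eqI)
      fix e
      have "ennreal (pmf E e) = ennreal (pmf (bind_pmf D K) e)"
        unfolding Eg ennreal_pmf_bind nn_integral_measure_pmf D ..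
      thus "pmf E e = pmf (bind_pmf (map_pmf ys D) closed_walk_pmf) e"
        by (simp add: bind_map_pmf K_def[abs_def])
    qed
  qed
qed

section \<open>Entropy of finite partitions\<close>

lemma neg_mult_ln_le_tangent:
  fixes p t :: real
  assumes "0 \<le> p" "0 < t"
  shows "- (p * ln p) \<le> - (p * ln t) + t - p"
proof (cases "p = 0")
  case False
  hence p: "0 < p" using assms by simp
  have "p * ln (t / p) \<le> p * (t / p - 1)"
    using p assms ln_le_minus_one[of "t / p"] by (intro mult_left_mono) auto
  thus ?thesis using p assms by (simp add: ln_div algebra_simps)
qed (use assms in auto)

text \<open>
  The points of the space that lie in \<open>l ! i\<close> at time \<open>i\<close>, for all \<open>i < length l\<close>.
\<close>

definition join_cell :: "'a measure \<Rightarrow> ('a \<Rightarrow> 'a) \<Rightarrow> 'a set list \<Rightarrow> 'a set" where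
  "join_cell \<mu> T l = {y \<in> space \<mu>. \<forall>i<length l. (T ^^ i) y \<in> l ! i}"

text \<open>
  The lists of length \<open>n\<close> of cells of the partition \<open>\<alpha>\<close>.
\<close>

definition itineraries :: "'a set set \<Rightarrow> nat \<Rightarrow> 'a set list set" where
  "itineraries \<alpha> n = {l. set l \<subseteq> \<alpha> \<and> length l = n}"

text \<open>
  For \<open>n = 0\<close> the join is a refinement of the empty family of partitions, hence \<open>{UNIV}\<close>; only \<open>n > 0\<close> is
  relevant for entropy.
\<close>

lemma iterated_join_eq:
  assumes "partition_on (space \<mu>) \<alpha>" and "0 < n"
  shows "iterated_join \<mu> T \<alpha> n = join_cell \<mu> T ` itineraries \<alpha> n - {{}}"
proof -
  define Q where "Q i = (\<lambda>A. (T ^^ i) -` A \<inter> space \<mu>) ` \<alpha>" for i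
  have Q: "X \<in> Q i \<longleftrightarrow> (\<exists>A\<in>\<alpha>. X = (T ^^ i) -` A \<inter> space \<mu>)" for X i
    by (auto simp: Q_def)
  have IJ: "iterated_join \<mu> T \<alpha> n = (\<Union>f \<in> (\<Pi> P\<in>Q ` {..<n}. P). {\<Inter> (f ` (Q ` {..<n}))}) - {{}}"
    unfolding iterated_join_def common_refinement Q_def ..
  have to_itinerary: "\<exists>l\<in>itineraries \<alpha> n. \<Inter> (f ` (Q ` {..<n})) = join_cell \<mu> T l"
    if f: "f \<in> (\<Pi> P\<in>Q ` {..<n}. P)" for f
  proof -
    have "\<exists>A\<in>\<alpha>. f (Q i) = (T ^^ i) -` A \<inter> space \<mu>" if "i < n" for i
      unfolding Q[symmetric] using f that by (auto simp: Pi_iff)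
    hence "\<forall>i\<in>{..<n}. \<exists>A. A \<in> \<alpha> \<and> f (Q i) = (T ^^ i) -` A \<inter> space \<mu>" by blast
    from bchoice[OF this] obtain A
      where A: "\<And>i. i < n \<Longrightarrow> A i \<in> \<alpha> \<and> f (Q i) = (T ^^ i) -` A i \<inter> space \<mu>"
      by blast
    have "map A [0..<n] \<in> itineraries \<alpha> n" using A by (auto simp: itineraries_def)
    moreover have "\<Inter> (f ` (Q ` {..<n})) = join_cell \<mu> T (map A [0..<n])"
      using A \<open>0 < n\<close> by (auto simp: join_cell_def)
    ultimately show ?thesis by blast
  qed
  have from_itinerary: "\<exists>f\<in>(\<Pi> P\<in>Q ` {..<n}. P). \<Inter> (f ` (Q ` {..<n})) = join_cell \<mu> T l"
    if l: "l \<in> itineraries \<alpha> n" and ne: "join_cell \<mu> T l \<noteq> {}" for l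
  proof -
    obtain x where x: "x \<in> join_cell \<mu> T l" using ne by auto
    have len: "length l = n" using l by (simp add: itineraries_def)
    define f where "f P = (SOME A. A \<in> P \<and> x \<in> A)" for P :: "'a set set"
    have f: "f (Q i) = (T ^^ i) -` (l ! i) \<inter> space \<mu>" if i: "i < n" for i
    proof -
      have li: "l ! i \<in> \<alpha>" using l i by (auto simp: itineraries_def)
      have "(T ^^ i) -` (l ! i) \<inter> space \<mu> \<in> Q i \<and> x \<in> (T ^^ i) -` (l ! i) \<inter> space \<mu>"
        using x i li len by (auto simp: join_cell_def Q)
      hence "f (Q i) \<in> Q i \<and> x \<in> f (Q i)" unfolding f_def by (rule someI)
      then obtain A where A: "A \<in> \<alpha>" "f (Q i) = (T ^^ i) -` A \<inter> space \<mu>" "(T ^^ i) x \<in> A"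
        using x unfolding Q by (auto simp: join_cell_def)
      have "(T ^^ i) x \<in> l ! i" using x i len by (auto simp: join_cell_def)
      hence "A = l ! i" using disjointD[of \<alpha> A "l ! i"] A li assms(1) by (auto simp: partition_on_def)
      thus ?thesis using A by simp
    qed
    have "f \<in> (\<Pi> P\<in>Q ` {..<n}. P)"
    proof (clarsimp simp: Pi_iff)
      fix i assume i: "i < n"
      have "l ! i \<in> \<alpha>" using l i by (auto simp: itineraries_def)
      thus "f (Q i) \<in> Q i" using f[OF i] unfolding Q by blast
    qed
    moreover have "\<Inter> (f ` (Q ` {..<n})) = join_cell \<mu> T l"
      using f \<open>0 < n\<close> len by (auto simp: join_cell_def)
    ultimately show ?thesis by blast
  qed
  show ?thesis
  proof (intro equalityI subsetI)
    fix C assume "C \<in> iterated_join \<mu> T \<alpha> n"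
    then obtain f where f: "f \<in> (\<Pi> P\<in>Q ` {..<n}. P)" and C: "C = \<Inter> (f ` (Q ` {..<n}))" "C \<noteq> {}"
      unfolding IJ by auto
    show "C \<in> join_cell \<mu> T ` itineraries \<alpha> n - {{}}"
      using to_itinerary[OF f] C by auto
  next
    fix C assume "C \<in> join_cell \<mu> T ` itineraries \<alpha> n - {{}}"
    then obtain l where l: "l \<in> itineraries \<alpha> n" and C: "C = join_cell \<mu> T l" "C \<noteq> {}" by auto
    obtain f where "f \<in> (\<Pi> P\<in>Q ` {..<n}. P)" "C = \<Inter> (f ` (Q ` {..<n}))"
      using from_itinerary[OF l] C by metis
    thus "C \<in> iterated_join \<mu> T \<alpha> n"
      unfolding IJ using C(2) by blast
  qed
qed

lemma
  assumes part: "partition_on (space \<mu>) \<alpha>" and fin: "finite \<alpha>" and sub: "\<alpha> \<subseteq> sets \<mu>"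
    and T: "T \<in> measurable \<mu> \<mu>" and n: "0 < n"
  shows finite_iterated_join: "finite (iterated_join \<mu> T \<alpha> n)"
    and card_iterated_join: "card (iterated_join \<mu> T \<alpha> n) \<le> card \<alpha> ^ n"
    and iterated_join_sets: "iterated_join \<mu> T \<alpha> n \<subseteq> sets \<mu>"
    and disjoint_iterated_join: "disjoint (iterated_join \<mu> T \<alpha> n)"
    and Union_iterated_join: "\<Union> (iterated_join \<mu> T \<alpha> n) = space \<mu>"
proof -
  let ?I = "itineraries \<alpha> n"
  have finI: "finite ?I" and cardI: "card ?I = card \<alpha> ^ n"
    unfolding itineraries_def using fin
    by (simp_all add: finite_lists_length_eq card_lists_length_eq)
  note eq = iterated_join_eq[OF part n, of T]
  have Ti: "(T ^^ i) \<in> measurable \<mu> \<mu>" for i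
    using T by (rule measurable_compose_n)
  show "finite (iterated_join \<mu> T \<alpha> n)" unfolding eq using finI by simp
  have "card (iterated_join \<mu> T \<alpha> n) \<le> card (join_cell \<mu> T ` ?I)"
    unfolding eq using finI by (intro card_mono) auto
  also have "\<dots> \<le> card ?I" by (rule card_image_le[OF finI])
  finally show "card (iterated_join \<mu> T \<alpha> n) \<le> card \<alpha> ^ n" by (simp add: cardI)
  have "join_cell \<mu> T l \<in> sets \<mu>" if "l \<in> ?I" for l
  proof -
    have l: "l ! i \<in> sets \<mu>" if "i < length l" for i
      using nth_mem[OF that] \<open>l \<in> ?I\<close> sub by (auto simp: itineraries_def)
    have "join_cell \<mu> T l = space \<mu> \<inter> (\<Inter>i\<in>{..<length l}. (T ^^ i) -` (l ! i) \<inter> space \<mu>)"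
      using that n by (auto simp: join_cell_def itineraries_def)
    also have "\<dots> \<in> sets \<mu>"
    proof (rule sets.Int[OF sets.top], rule sets.finite_INT)
      show "{..<length l} \<noteq> {}" using that n by (auto simp: itineraries_def)
      show "(T ^^ i) -` (l ! i) \<inter> space \<mu> \<in> sets \<mu>" if "i \<in> {..<length l}" for i
        using that by (intro measurable_sets[OF Ti l]) simp
    qed simp
    finally show ?thesis .
  qed
  thus "iterated_join \<mu> T \<alpha> n \<subseteq> sets \<mu>" unfolding eq by auto
  show "disjoint (iterated_join \<mu> T \<alpha> n)"
    unfolding eq disjoint_def
  proof (intro ballI impI)
    fix C D assume "C \<in> join_cell \<mu> T ` ?I - {{}}" "D \<in> join_cell \<mu> T ` ?I - {{}}" and ne: "C \<noteq> D"
    then obtain k l where kl: "k \<in> ?I" "l \<in> ?I" "C = join_cell \<mu> T k" "D = join_cell \<mu> T l" by auto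
    show "C \<inter> D = {}"
    proof (rule ccontr)
      assume "C \<inter> D \<noteq> {}"
      then obtain x where x: "x \<in> C" "x \<in> D" by auto
      have "k = l"
      proof (rule nth_equalityI)
        show "length k = length l" using kl by (simp add: itineraries_def)
        fix i assume i: "i < length k"
        have "k ! i \<in> \<alpha>" "l ! i \<in> \<alpha>" using kl i by (auto simp: itineraries_def)
        moreover have "(T ^^ i) x \<in> k ! i" "(T ^^ i) x \<in> l ! i"
          using x kl i by (auto simp: join_cell_def itineraries_def)
        ultimately show "k ! i = l ! i" using part by (auto simp: partition_on_def disjoint_def)
      qed
      thus False using ne kl by simp
    qed
  qed
  show "\<Union> (iterated_join \<mu> T \<alpha> n) = space \<mu>"
  proof
    show "\<Union> (iterated_join \<mu> T \<alpha> n) \<subseteq> space \<mu>" unfolding eq by (auto simp: join_cell_def)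
    show "space \<mu> \<subseteq> \<Union> (iterated_join \<mu> T \<alpha> n)"
    proof
      fix x assume x: "x \<in> space \<mu>"
      have "\<exists>A\<in>\<alpha>. (T ^^ i) x \<in> A" for i
        using measurable_space[OF Ti x] part by (auto simp: partition_on_def)
      then obtain A where A: "\<And>i. A i \<in> \<alpha> \<and> (T ^^ i) x \<in> A i" by metis
      have "map A [0..<n] \<in> ?I" "x \<in> join_cell \<mu> T (map A [0..<n])"
        using A x by (auto simp: itineraries_def join_cell_def)
      thus "x \<in> \<Union> (iterated_join \<mu> T \<alpha> n)" unfolding eq by blast
    qed
  qed
qed

lemma (in finite_measure) sum_measure_disjoint:
  assumes "finite J" "J \<subseteq> sets M" "disjoint J"
  shows "(\<Sum>C\<in>J. measure M C) = measure M (\<Union>J)"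
proof -
  have "disjoint_family_on (\<lambda>C. C) J" using assms(3) by (simp add: disjoint_family_on_def disjoint_def)
  thus ?thesis using finite_measure_finite_Union[of J "\<lambda>C. C"] assms(1,2) by simp
qed

lemma partition_entropy_ge:
  assumes "(\<Sum>C\<in>J. measure \<mu> C) = 1" and "0 < t" and le: "\<And>C. C \<in> J \<Longrightarrow> measure \<mu> C \<le> t"
  shows "- ln t \<le> partition_entropy \<mu> J"
proof -
  have "(\<Sum>C\<in>J. measure \<mu> C * ln (measure \<mu> C)) \<le> (\<Sum>C\<in>J. measure \<mu> C * ln t)"
  proof (rule sum_mono)
    fix C assume "C \<in> J"
    thus "measure \<mu> C * ln (measure \<mu> C) \<le> measure \<mu> C * ln t"
      using le[of C] assms(2)
      by (cases "measure \<mu> C = 0") (auto intro!: mult_left_mono simp: less_le)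
  qed
  also have "\<dots> = ln t" by (simp add: sum_distrib_right[symmetric] assms(1))
  finally show ?thesis by (simp add: partition_entropy_def)
qed

lemma partition_entropy_le:
  assumes "finite J" and "(\<Sum>C\<in>J. measure \<mu> C) = 1"
    and K: "card {C \<in> J. measure \<mu> C \<noteq> 0} \<le> K" and "0 < K"
  shows "partition_entropy \<mu> J \<le> ln (real K)"
proof -
  let ?J = "{C \<in> J. measure \<mu> C \<noteq> 0}"
  have one: "(\<Sum>C\<in>?J. measure \<mu> C) = 1"
    using assms(1,2) by (subst sum.mono_neutral_left[of J]) auto
  have "partition_entropy \<mu> J = (\<Sum>C\<in>?J. - (measure \<mu> C * ln (measure \<mu> C)))"
    unfolding partition_entropy_def sum_negf
    using assms(1) by (subst sum.mono_neutral_left[of J ?J]) auto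
  also have "\<dots> \<le> (\<Sum>C\<in>?J. measure \<mu> C * ln (real K) + 1 / real K - measure \<mu> C)"
    using neg_mult_ln_le_tangent[of _ "1 / real K"] \<open>0 < K\<close>
    by (intro sum_mono) (simp add: ln_div)
  also have "\<dots> = ln (real K) + real (card ?J) / real K - 1"
    by (simp add: sum.distrib sum_subtractf sum_distrib_right[symmetric] one)
  also have "\<dots> \<le> ln (real K)" using K \<open>0 < K\<close> by (simp add: divide_le_eq)
  finally show ?thesis .
qed

lemma pmf_finite_subset:
  fixes p :: "'a pmf"
  assumes "0 < \<delta>"
  obtains F where "finite F" and "measure (measure_pmf p) (- F) < \<delta>"
proof -
  define F where "F n = {x \<in> set_pmf p. to_nat_on (set_pmf p) x < n}" for n
  have inj: "inj_on (to_nat_on (set_pmf p)) (set_pmf p)"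
    by (rule inj_on_to_nat_on) (rule countable_set_pmf)
  have fin: "finite (F n)" for n
    by (rule finite_imageD[of "to_nat_on (set_pmf p)"], rule finite_subset[of _ "{..<n}"])
       (auto simp: F_def intro: inj_on_subset[OF inj])
  have "(\<lambda>n. measure (measure_pmf p) (F n)) \<longlonglongrightarrow> measure (measure_pmf p) (\<Union>n. F n)"
    by (rule measure_pmf.finite_Lim_measure_incseq) (auto simp: F_def incseq_def)
  also have "(\<Union>n. F n) = set_pmf p" by (auto simp: F_def)
  also have "measure (measure_pmf p) (set_pmf p) = 1"
    by (simp add: measure_pmf.prob_eq_1 AE_measure_pmf_iff)
  finally obtain n where n: "1 - \<delta> < measure (measure_pmf p) (F n)"
    using assms order_tendstoD(1)[of _ 1 sequentially "1 - \<delta>"]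
    by (fastforce dest: eventually_happens'[rotated])
  have "measure (measure_pmf p) (- F n) = 1 - measure (measure_pmf p) (F n)"
    using measure_pmf.prob_compl[of "F n" p] by (simp add: Compl_eq_Diff_UNIV)
  thus thesis using n by (intro that[OF fin[of n]]) simp
qed

text \<open>
  At most \<open>card F\<close> cells meet the finite set \<open>F\<close>, and each contributes at most 1.  The remaining
  cells have total mass at most \<open>\<delta>\<close>, and there are at most \<open>N\<close> of them.
\<close>

lemma partition_entropy_atomic_le:
  fixes p :: "'a pmf"
  assumes at: "\<And>C. C \<in> J \<Longrightarrow> measure \<mu> C = measure (measure_pmf p) C"
    and J: "finite J" "disjoint J" "card J \<le> N" and N: "0 < N"
    and F: "finite F" "measure (measure_pmf p) (- F) \<le> \<delta>"
  shows "partition_entropy \<mu> J \<le> real (card F) + \<delta> * ln (real N) + 1"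
proof -
  let ?m = "measure (measure_pmf p)"
  define J1 where "J1 = {C \<in> J. C \<inter> F \<noteq> {}}"
  define J2 where "J2 = {C \<in> J. C \<inter> F = {}}"
  have fin: "finite J1" "finite J2" using J(1) by (auto simp: J1_def J2_def)
  have J12: "J = J1 \<union> J2" "J1 \<inter> J2 = {}" by (auto simp: J1_def J2_def)
  define c where "c C = (SOME x. x \<in> C \<inter> F)" for C
  have c: "c C \<in> C \<inter> F" if "C \<in> J1" for C
  proof -
    have "\<exists>x. x \<in> C \<inter> F" using that by (auto simp: J1_def)
    thus ?thesis unfolding c_def by (rule someI_ex)
  qed
  have "inj_on c J1"
  proof (rule inj_onI)
    fix C D assume "C \<in> J1" "D \<in> J1" "c C = c D"
    have "c C \<in> C" "c D \<in> D" using c \<open>C \<in> J1\<close> \<open>D \<in> J1\<close> by blast+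
    moreover have "C \<in> J" "D \<in> J" using \<open>C \<in> J1\<close> \<open>D \<in> J1\<close> by (simp_all add: J1_def)
    ultimately show "C = D" using disjointD[OF J(2), of C D] \<open>c C = c D\<close> by auto
  qed
  hence card1: "card J1 \<le> card F" using c F(1) by (intro card_inj_on_le[of c J1 F]) blast+
  have le1: "(\<Sum>C\<in>J1. - (?m C * ln (?m C))) \<le> (\<Sum>C\<in>J1. 1)"
  proof (rule sum_mono)
    fix C show "- (?m C * ln (?m C)) \<le> 1"
      using neg_mult_ln_le_tangent[of "?m C" 1] measure_nonneg[of "measure_pmf p" C]
      unfolding ln_one by linarith
  qed
  have "(\<Sum>C\<in>J2. ?m C) = ?m (\<Union>J2)"
    using disjointD[OF J(2)]
    by (intro measure_pmf.sum_measure_disjoint fin) (simp, unfold disjoint_def J2_def, blast)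
  also have "\<dots> \<le> ?m (- F)"
    by (intro measure_pmf.finite_measure_mono) (simp_all, unfold J2_def, blast)
  finally have m2: "(\<Sum>C\<in>J2. ?m C) \<le> \<delta>" using F(2) by simp
  have c2: "card J2 \<le> N" using J(1,3) card_mono[of J J2] by (auto simp: J2_def)
  have "(\<Sum>C\<in>J2. - (?m C * ln (?m C))) \<le> (\<Sum>C\<in>J2. ?m C * ln (real N) + 1 / real N)"
  proof (rule sum_mono)
    fix C
    have "- (?m C * ln (?m C)) \<le> ?m C * ln (real N) + 1 / real N - ?m C"
      using neg_mult_ln_le_tangent[of "?m C" "1 / real N"] N by (simp add: ln_div)
    thus "- (?m C * ln (?m C)) \<le> ?m C * ln (real N) + 1 / real N"
      using measure_nonneg[of "measure_pmf p" C] by linarith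
  qed
  also have "\<dots> = (\<Sum>C\<in>J2. ?m C) * ln (real N) + real (card J2) / real N"
    by (simp add: sum.distrib sum_distrib_right)
  also have "\<dots> \<le> \<delta> * ln (real N) + 1"
    using m2 c2 N by (intro add_mono mult_right_mono) auto
  finally have le2: "(\<Sum>C\<in>J2. - (?m C * ln (?m C))) \<le> \<delta> * ln (real N) + 1" .
  have "partition_entropy \<mu> J = (\<Sum>C\<in>J. - (?m C * ln (?m C)))"
    by (simp add: partition_entropy_def sum_negf at)
  also have "\<dots> = (\<Sum>C\<in>J1. - (?m C * ln (?m C))) + (\<Sum>C\<in>J2. - (?m C * ln (?m C)))"
    unfolding J12(1) using fin J12(2) by (rule sum.union_disjoint)
  finally show ?thesis using le1 le2 card1 by simp
qed

text \<open>
  A measure carried by countably many atoms has entropy zero: for a finite partition with \<open>k\<close>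
  cells, the preceding bound with \<open>N = k ^ n\<close> gives \<open>H n / n \<le> \<delta> * ln k + o(1)\<close> for
  every \<open>\<delta> > 0\<close>.
\<close>

lemma measure_entropy_atomic:
  fixes p :: "'a pmf"
  assumes "prob_space \<mu>" and T: "T \<in> measurable \<mu> \<mu>"
    and at: "\<And>C. C \<in> sets \<mu> \<Longrightarrow> measure \<mu> C = measure (measure_pmf p) C"
  shows "measure_entropy \<mu> T = 0"
proof -
  interpret prob_space \<mu> by fact
  have ew: "entropy_wrt_partition \<mu> T \<alpha> = 0"
    if \<alpha>: "finite \<alpha>" "partition_on (space \<mu>) \<alpha>" "\<alpha> \<subseteq> sets \<mu>" for \<alpha>
  proof -
    let ?J = "iterated_join \<mu> T \<alpha>"
    let ?N = "card \<alpha>"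
    have "\<alpha> \<noteq> {}" using \<alpha>(2) not_empty by (auto simp: partition_on_def)
    hence N: "0 < ?N" using \<alpha>(1) by (simp add: card_gt_0_iff)
    note J = finite_iterated_join[OF \<alpha>(2,1,3) T] card_iterated_join[OF \<alpha>(2,1,3) T]
      iterated_join_sets[OF \<alpha>(2,1,3) T] disjoint_iterated_join[OF \<alpha>(2,1,3) T]
    have ge: "0 \<le> partition_entropy \<mu> (?J n)" for n
    proof -
      have "prob C * ln (prob C) \<le> 0" for C
        by (cases "prob C = 0") (auto intro!: mult_nonneg_nonpos simp: less_le)
      thus ?thesis unfolding partition_entropy_def by (simp add: sum_nonpos)
    qed
    have "(\<lambda>n. partition_entropy \<mu> (?J n) / real n) \<longlonglongrightarrow> 0"
    proof (rule LIMSEQ_I)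
      fix e :: real assume e: "0 < e"
      have lnN: "0 \<le> ln (real ?N)" using N by simp
      define \<delta> where "\<delta> = e / (2 * (ln (real ?N) + 1))"
      have \<delta>: "0 < \<delta>" using e lnN by (simp add: \<delta>_def)
      obtain F where F: "finite F" "measure (measure_pmf p) (- F) < \<delta>"
        using pmf_finite_subset[OF \<delta>] by blast
      have \<delta>N: "\<delta> * ln (real ?N) < e / 2"
        using e lnN by (simp add: \<delta>_def field_simps)
      obtain n0 :: nat where n0: "(real (card F) + 1) / (e / 2) < real n0" using reals_Archimedean2 by blast
      show "\<exists>no. \<forall>n\<ge>no. norm (partition_entropy \<mu> (?J n) / real n - 0) < e"
      proof (intro exI[of _ "Suc n0"] allI impI)
        fix n assume n: "Suc n0 \<le> n"
        hence n': "0 < n" by simp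
        have "partition_entropy \<mu> (?J n) \<le> real (card F) + \<delta> * ln (real (?N ^ n)) + 1"
          using J[OF n'] N F by (intro partition_entropy_atomic_le[where p=p] at) auto
        also have "\<dots> = real n * (\<delta> * ln (real ?N)) + (real (card F) + 1)"
          using N by (simp add: ln_realpow)
        also have "\<dots> < real n * (e / 2) + real n * (e / 2)"
        proof (rule add_le_less_mono)
          show "real n * (\<delta> * ln (real ?N)) \<le> real n * (e / 2)" using \<delta>N by (intro mult_left_mono) auto
          have "real (card F) + 1 < real n0 * (e / 2)" using n0 e by (simp add: field_simps)
          also have "\<dots> \<le> real n * (e / 2)" using n e by (intro mult_right_mono) auto
          finally show "real (card F) + 1 < real n * (e / 2)" .
        qed
        finally show "norm (partition_entropy \<mu> (?J n) / real n - 0) < e"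
          using n' ge[of n] by (simp add: field_simps)
      qed
    qed
    thus ?thesis unfolding entropy_wrt_partition_def by (rule limI)
  qed
  have "{space \<mu>} \<in> {\<alpha>. finite \<alpha> \<and> partition_on (space \<mu>) \<alpha> \<and> \<alpha> \<subseteq> sets \<mu>}"
    using not_empty by (auto simp: partition_on_def)
  hence "{\<alpha>. finite \<alpha> \<and> partition_on (space \<mu>) \<alpha> \<and> \<alpha> \<subseteq> sets \<mu>} \<noteq> {}" by blast
  thus ?thesis
    unfolding measure_entropy_def by (rule SUP_eq_const) (simp add: ew)
qed

lemma measure_entropy_ge:
  assumes "finite \<alpha>" "partition_on (space \<mu>) \<alpha>" "\<alpha> \<subseteq> sets \<mu>"
    and "(\<lambda>n. partition_entropy \<mu> (iterated_join \<mu> T \<alpha> n) / real n) \<longlonglongrightarrow> h"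
  shows "ereal h \<le> measure_entropy \<mu> T"
proof -
  have "ereal (entropy_wrt_partition \<mu> T \<alpha>) \<le> measure_entropy \<mu> T"
    unfolding measure_entropy_def using assms(1-3) by (intro SUP_upper) simp
  thus ?thesis unfolding entropy_wrt_partition_def limI[OF assms(4)] .
qed

section \<open>Countably supported invariant measures\<close>

abbreviation shift_borel :: "(nat \<Rightarrow> nat \<Rightarrow> nat) \<Rightarrow> (nat \<Rightarrow> nat) measure" where
  "shift_borel M \<equiv> restrict_space borel (shift_space M)"

lemma space_shift_borel: "space (shift_borel M) = shift_space M"
  by (simp add: space_restrict_space)

lemma shift_in_shift_space: "x \<in> shift_space M \<Longrightarrow> shift x \<in> shift_space M"
  by (simp add: shift_space_def shift_def)

lemma measurable_shift_borel_coordinate: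
  "(\<lambda>x. x i) \<in> measurable (shift_borel M) (count_space UNIV)"
proof -
  have "(\<lambda>x :: nat \<Rightarrow> nat. x i) \<in> measurable borel borel"
    by (intro borel_measurable_continuous_onI continuous_on_product_coordinates)
  also have "measurable borel borel = measurable borel (count_space (UNIV :: nat set))"
    by (intro measurable_cong_sets sets_borel_eq_count_space refl)
  finally show ?thesis by (rule measurable_restrict_space1)
qed

lemma measurable_shift_borelI:
  assumes "\<And>i. (\<lambda>w. f w i) \<in> measurable N (count_space (UNIV :: nat set))"
    and "\<And>w. w \<in> space N \<Longrightarrow> f w \<in> shift_space M"
  shows "f \<in> measurable N (shift_borel M)"
proof (rule measurable_restrict_space2)
  show "f \<in> space N \<rightarrow> shift_space M" using assms(2) by auto
  have "(\<lambda>w. f w i) \<in> measurable N (borel :: nat measure)" for i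
    using assms(1)[of i] measurable_cong_sets[OF refl sets_borel_eq_count_space[where 'a=nat], of N] by simp
  hence "f \<in> measurable N (PiM UNIV (\<lambda>_. borel))"
    by (intro measurable_PiM_single') auto
  moreover have "measurable N (PiM UNIV (\<lambda>_ :: nat. borel :: nat measure)) = borel_measurable N"
    by (rule measurable_cong_sets[OF refl sets_PiM_equal_borel])
  ultimately show "f \<in> borel_measurable N" by blast
qed

lemma measurable_shift: "shift \<in> measurable (shift_borel M) (shift_borel M)"
  by (rule measurable_shift_borelI)
     (auto simp: shift_def[abs_def] space_shift_borel intro: measurable_shift_borel_coordinate
        shift_in_shift_space[unfolded shift_def])

lemma continuous_on_shift_space_measurable:
  fixes f :: "(nat \<Rightarrow> nat) \<Rightarrow> real"
  shows "continuous_on (shift_space M) f \<Longrightarrow> f \<in> borel_measurable (shift_borel M)"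
  by (rule borel_measurable_continuous_on_restrict)

text \<open>
  Countably supported invariant measures are handled as probability mass functions on the full
  sequence space, supported in the shift space.
\<close>
definition invariant_pmf :: "(nat \<Rightarrow> nat \<Rightarrow> nat) \<Rightarrow> (nat \<Rightarrow> nat) pmf \<Rightarrow> bool" where
  "invariant_pmf M p \<longleftrightarrow> set_pmf p \<subseteq> shift_space M \<and> map_pmf shift p = p"

text \<open>
  The Borel probability measure on the shift space induced by a mass function; it restricts a
  measure on all subsets to the Borel sets.
\<close>

definition atomic_measure :: "(nat \<Rightarrow> nat \<Rightarrow> nat) \<Rightarrow> (nat \<Rightarrow> nat) pmf \<Rightarrow> (nat \<Rightarrow> nat) measure" where
  "atomic_measure M p = distr (restrict_space (measure_pmf p) (shift_space M)) (shift_borel M) (\<lambda>x. x)"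

lemma invariant_pmf_bind:
  "(\<And>j. j \<in> set_pmf Q \<Longrightarrow> invariant_pmf M (r j)) \<Longrightarrow> invariant_pmf M (bind_pmf Q r)"
  unfolding invariant_pmf_def
  by (auto simp: map_bind_pmf intro!: bind_pmf_cong)

lemma sets_atomic_measure: "sets (atomic_measure M p) = sets (shift_borel M)"
  by (simp add: atomic_measure_def)

lemma space_atomic_measure: "space (atomic_measure M p) = shift_space M"
  by (simp add: atomic_measure_def space_shift_borel)

lemma measurable_atomic_measure_id:
  "(\<lambda>x. x) \<in> measurable (restrict_space (measure_pmf p) (shift_space M)) (shift_borel M)"
proof (rule measurable_restrict_space2)
  show "(\<lambda>x. x) \<in> space (restrict_space (measure_pmf p) (shift_space M)) \<rightarrow> shift_space M"
    by (simp add: space_restrict_space)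
  show "(\<lambda>x. x) \<in> borel_measurable (restrict_space (measure_pmf p) (shift_space M))"
    by (rule measurable_restrict_space1) simp
qed

lemma nn_integral_atomic_measure:
  assumes "set_pmf p \<subseteq> shift_space M" and "f \<in> borel_measurable (shift_borel M)"
  shows "(\<integral>\<^sup>+x. f x \<partial>atomic_measure M p) = (\<integral>\<^sup>+x. f x \<partial>measure_pmf p)"
proof -
  have "(\<integral>\<^sup>+x. f x \<partial>atomic_measure M p) = (\<integral>\<^sup>+x. f x * indicator (shift_space M) x \<partial>measure_pmf p)"
    unfolding atomic_measure_def
    using assms(2) by (simp add: nn_integral_distr measurable_atomic_measure_id nn_integral_restrict_space)
  also have "\<dots> = (\<integral>\<^sup>+x. f x \<partial>measure_pmf p)"
    using assms(1) by (intro nn_integral_cong_AE) (auto simp: AE_measure_pmf_iff indicator_def)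
  finally show ?thesis .
qed

lemma integral_atomic_measure:
  fixes f :: "(nat \<Rightarrow> nat) \<Rightarrow> real"
  assumes "set_pmf p \<subseteq> shift_space M" and "f \<in> borel_measurable (shift_borel M)"
  shows "(\<integral>x. f x \<partial>atomic_measure M p) = measure_pmf.expectation p f"
proof -
  have "(\<integral>x. f x \<partial>atomic_measure M p) = (\<integral>x. indicator (shift_space M) x *\<^sub>R f x \<partial>measure_pmf p)"
    unfolding atomic_measure_def
    by (simp add: integral_distr[OF measurable_atomic_measure_id assms(2)] integral_restrict_space)
  also have "\<dots> = measure_pmf.expectation p f"
    using assms(1) by (intro integral_cong_AE) (auto simp: AE_measure_pmf_iff indicator_def)
  finally show ?thesis .
qed

lemma emeasure_atomic_measure:
  assumes "set_pmf p \<subseteq> shift_space M" and "C \<in> sets (shift_borel M)"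
  shows "emeasure (atomic_measure M p) C = emeasure (measure_pmf p) C"
proof -
  have "emeasure (atomic_measure M p) C = (\<integral>\<^sup>+x. indicator C x \<partial>atomic_measure M p)"
    using assms(2) by (simp add: sets_atomic_measure)
  also have "\<dots> = (\<integral>\<^sup>+x. indicator C x \<partial>measure_pmf p)"
    using assms by (intro nn_integral_atomic_measure) simp_all
  finally show ?thesis by simp
qed

lemma prob_space_atomic_measure:
  assumes "set_pmf p \<subseteq> shift_space M"
  shows "prob_space (atomic_measure M p)"
proof
  have "shift_space M \<in> sets (shift_borel M)"
    by (metis sets.top space_shift_borel)
  hence "emeasure (atomic_measure M p) (shift_space M) = emeasure (measure_pmf p) (shift_space M)"
    by (rule emeasure_atomic_measure[OF assms])
  also have "\<dots> = 1"
    using assms by (intro measure_pmf.emeasure_eq_1_AE) (auto simp: AE_measure_pmf_iff)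
  finally show "emeasure (atomic_measure M p) (space (atomic_measure M p)) = 1"
    by (simp add: space_atomic_measure)
qed

lemma atomic_measure_invariant:
  assumes "invariant_pmf M p"
  shows "atomic_measure M p \<in> invariant_measures M"
proof -
  have p: "set_pmf p \<subseteq> shift_space M" "map_pmf shift p = p" using assms by (auto simp: invariant_pmf_def)
  let ?\<mu> = "atomic_measure M p"
  have shift: "shift \<in> measurable ?\<mu> ?\<mu>"
    using measurable_shift[of M] by (simp add: measurable_cong_sets[OF sets_atomic_measure sets_atomic_measure])
  have "distr ?\<mu> ?\<mu> shift = ?\<mu>"
  proof (rule measure_eqI)
    fix C assume "C \<in> sets (distr ?\<mu> ?\<mu> shift)"
    hence C: "C \<in> sets (shift_borel M)" by (simp add: sets_atomic_measure)
    have "emeasure (distr ?\<mu> ?\<mu> shift) C = (\<integral>\<^sup>+x. indicator C (shift x) \<partial>?\<mu>)"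
    proof -
      have "(\<integral>\<^sup>+x. indicator C x \<partial>distr ?\<mu> ?\<mu> shift) = (\<integral>\<^sup>+x. indicator C (shift x) \<partial>?\<mu>)"
        using C by (intro nn_integral_distr shift borel_measurable_indicator) (simp add: sets_atomic_measure)
      thus ?thesis using C by (simp add: sets_atomic_measure)
    qed
    also have "\<dots> = (\<integral>\<^sup>+x. indicator C (shift x) \<partial>measure_pmf p)"
      by (intro nn_integral_atomic_measure p measurable_compose[OF measurable_shift]
          borel_measurable_indicator C)
    also have "\<dots> = (\<integral>\<^sup>+x. indicator C x \<partial>measure_pmf (map_pmf shift p))"
      by (simp only: nn_integral_map_pmf)
    also have "\<dots> = emeasure ?\<mu> C" by (simp add: p emeasure_atomic_measure C)
    finally show "emeasure (distr ?\<mu> ?\<mu> shift) C = emeasure ?\<mu> C" .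
  qed simp
  thus ?thesis using prob_space_atomic_measure[OF p(1)]
    by (simp add: invariant_measures_def sets_atomic_measure)
qed

lemma measure_entropy_atomic_measure:
  assumes "invariant_pmf M p"
  shows "measure_entropy (atomic_measure M p) shift = 0"
proof (rule measure_entropy_atomic)
  have p: "set_pmf p \<subseteq> shift_space M" using assms by (auto simp: invariant_pmf_def)
  show "prob_space (atomic_measure M p)" by (rule prob_space_atomic_measure[OF p])
  show "shift \<in> measurable (atomic_measure M p) (atomic_measure M p)"
    using measurable_shift[of M] by (simp add: measurable_cong_sets[OF sets_atomic_measure sets_atomic_measure])
  show "measure (atomic_measure M p) C = measure (measure_pmf p) C" if "C \<in> sets (atomic_measure M p)" for C
    using that by (simp add: measure_def emeasure_atomic_measure[OF p] sets_atomic_measure)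
qed

section \<open>Free energy of mixtures\<close>

text \<open>
  For a potential bounded above by \<open>C\<close>, the extended integral is expressed through the single
  nonnegative integral of \<open>C - \<phi>\<close>, which is additive over countable mixtures of measures without
  any integrability assumption.
\<close>

lemma extended_integral_eq:
  assumes "prob_space \<nu>" and [measurable]: "\<phi> \<in> borel_measurable \<nu>"
    and C: "0 \<le> C" "\<And>x. x \<in> space \<nu> \<Longrightarrow> \<phi> x \<le> C"
  shows "extended_integral \<nu> \<phi> = ereal C - enn2ereal (\<integral>\<^sup>+x. ennreal (C - \<phi> x) \<partial>\<nu>)"
proof -
  interpret prob_space \<nu> by fact
  define X where "X = (\<integral>\<^sup>+x. ennreal (C - \<phi> x) \<partial>\<nu>)"
  define P where "P = (\<integral>\<^sup>+x. ennreal (\<phi> x) \<partial>\<nu>)"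
  define N where "N = (\<integral>\<^sup>+x. ennreal (- \<phi> x) \<partial>\<nu>)"
  have "X + P = (\<integral>\<^sup>+x. ennreal (C - \<phi> x) + ennreal (\<phi> x) \<partial>\<nu>)"
    unfolding X_def P_def by (rule nn_integral_add[symmetric]) measurable
  also have "\<dots> = (\<integral>\<^sup>+x. ennreal C + ennreal (- \<phi> x) \<partial>\<nu>)"
  proof (rule nn_integral_cong)
    fix x assume "x \<in> space \<nu>"
    hence "\<phi> x \<le> C" by (rule C)
    thus "ennreal (C - \<phi> x) + ennreal (\<phi> x) = ennreal C + ennreal (- \<phi> x)"
      using C(1) by (cases "0 \<le> \<phi> x")
        (simp_all add: ennreal_plus[symmetric] ennreal_neg del: ennreal_plus)
  qed
  also have "\<dots> = ennreal C + N"
    unfolding N_def by (subst nn_integral_add) (simp_all add: emeasure_space_1)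
  finally have eq: "X + P = ennreal C + N" .
  have "P \<le> (\<integral>\<^sup>+x. ennreal C \<partial>\<nu>)"
    unfolding P_def using C by (intro nn_integral_mono ennreal_leI)
  hence "P \<noteq> \<infinity>" by (auto simp: emeasure_space_1 top_unique)
  then obtain p where p: "P = ennreal p" "0 \<le> p" by (cases P) auto
  show ?thesis
  proof (cases "N = \<infinity>")
    case True
    hence "X = \<infinity>" using eq p by (cases X) (auto simp: ennreal_plus[symmetric] simp del: ennreal_plus)
    thus ?thesis using True by (simp add: extended_integral_def X_def N_def)
  next
    case False
    then obtain n where n: "N = ennreal n" "0 \<le> n" by (cases N) auto
    have "X \<noteq> \<infinity>" using eq n p C by (auto simp: ennreal_plus[symmetric] simp del: ennreal_plus)
    then obtain x where x: "X = ennreal x" "0 \<le> x" by (cases X) auto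
    have "x + p = C + n" using eq n p x C
      by (simp add: ennreal_plus[symmetric] del: ennreal_plus)
    hence "p - n = C - x" by simp
    thus ?thesis using False n p x
      by (simp add: extended_integral_def X_def[symmetric] N_def[symmetric] P_def[symmetric] enn2ereal_ennreal)
  qed
qed

text \<open>
  If an average of values that are at least \<open>\<Gamma>\<close> equals \<open>\<Gamma>\<close>, then all values with positive
  weight equal \<open>\<Gamma>\<close>.
\<close>

lemma bind_pmf_nn_integral_minimal:
  assumes ge: "\<And>j. j \<in> set_pmf Q \<Longrightarrow> \<Gamma> \<le> (\<integral>\<^sup>+x. F x \<partial>measure_pmf (r j))"
    and eq: "(\<integral>\<^sup>+x. F x \<partial>measure_pmf (bind_pmf Q r)) = \<Gamma>" and fin: "\<Gamma> < \<infinity>"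
    and j: "j \<in> set_pmf Q"
  shows "(\<integral>\<^sup>+x. F x \<partial>measure_pmf (r j)) = \<Gamma>"
proof -
  let ?G = "\<lambda>j. \<integral>\<^sup>+x. F x \<partial>measure_pmf (r j)"
  have "(\<integral>\<^sup>+j. ?G j - \<Gamma> \<partial>measure_pmf Q) = (\<integral>\<^sup>+j. ?G j \<partial>measure_pmf Q) - (\<integral>\<^sup>+j. \<Gamma> \<partial>measure_pmf Q)"
    using fin ge by (intro nn_integral_diff) (auto simp: AE_measure_pmf_iff)
  also have "\<dots> = 0" using eq fin by simp
  finally have "AE j in measure_pmf Q. ?G j - \<Gamma> = 0"
    by (subst (asm) nn_integral_0_iff_AE) simp_all
  hence "?G j - \<Gamma> = 0" using j by (simp add: AE_measure_pmf_iff)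
  thus ?thesis using ge[OF j] fin by (auto simp: diff_eq_0_iff_ennreal intro: antisym)
qed

text \<open>
  The measures \<open>\<rho> k\<close> and the measure \<open>\<nu>\<close> of positive entropy are linked only by the hypothesis
  \<open>Fatou\<close>, a form of Fatou's lemma for \<open>\<rho> k\<close> converging to \<open>\<nu>\<close>; the function \<open>f\<close> need not be
  bounded.
\<close>

theorem atomic_mixture_not_equilibrium:
  fixes \<rho> :: "nat \<Rightarrow> (nat \<Rightarrow> nat) pmf" and \<epsilon> :: real
  assumes p: "invariant_pmf M p" and \<rho>: "\<And>k. invariant_pmf M (\<rho> k)"
    and Q: "set_pmf Q = UNIV" and \<epsilon>: "0 < \<epsilon>" "\<epsilon> < 1"
    and \<nu>: "\<nu> \<in> invariant_measures M" and h: "0 < measure_entropy \<nu> shift"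
    and Fatou: "\<And>f :: (nat \<Rightarrow> nat) \<Rightarrow> real. \<And>\<Gamma>. continuous_on (shift_space M) f \<Longrightarrow>
       (\<And>k. (\<integral>\<^sup>+x. ennreal (f x) \<partial>measure_pmf (\<rho> k)) = \<Gamma>) \<Longrightarrow> (\<integral>\<^sup>+x. ennreal (f x) \<partial>\<nu>) \<le> \<Gamma>"
    and \<phi>: "continuous_on (shift_space M) \<phi>" "bdd_above (\<phi> ` shift_space M)"
  shows "\<not> equilibrium_measure M \<phi>
     (atomic_measure M (bind_pmf (bernoulli_pmf \<epsilon>) (\<lambda>b. if b then bind_pmf Q \<rho> else p)))"
proof
  \<comment> \<open>Below, \<open>G r\<close> is the integral of \<open>C - \<phi>\<close>, so that the free energy of an atomic measure is \<open>C - G r\<close>.\<close>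
  define q where "q = bind_pmf Q \<rho>"
  define m where "m = bind_pmf (bernoulli_pmf \<epsilon>) (\<lambda>b. if b then q else p)"
  assume "equilibrium_measure M \<phi>
     (atomic_measure M (bind_pmf (bernoulli_pmf \<epsilon>) (\<lambda>b. if b then bind_pmf Q \<rho> else p)))"
  hence "equilibrium_measure M \<phi> (atomic_measure M m)" unfolding m_def q_def .
  hence J: "extended_integral (atomic_measure M m) \<phi> > - \<infinity>"
    and eqP: "measure_entropy (atomic_measure M m) shift + extended_integral (atomic_measure M m) \<phi> = pressure M \<phi>"
    by (auto simp: equilibrium_measure_def)
  have q: "invariant_pmf M q" unfolding q_def by (intro invariant_pmf_bind \<rho>)
  have m: "invariant_pmf M m" unfolding m_def by (rule invariant_pmf_bind) (use p q in auto)
  obtain C0 where C0: "\<And>x. x \<in> shift_space M \<Longrightarrow> \<phi> x \<le> C0" using \<phi>(2) by (auto simp: bdd_above_def)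
  define C where "C = max 0 C0"
  have C: "0 \<le> C" "\<And>x. x \<in> shift_space M \<Longrightarrow> \<phi> x \<le> C" using C0 by (auto simp: C_def le_max_iff_disj)
  have meas: "\<phi> \<in> borel_measurable (shift_borel M)"
    using \<phi>(1) by (rule continuous_on_shift_space_measurable)
  have ext: "extended_integral \<nu>' \<phi> = ereal C - enn2ereal (\<integral>\<^sup>+x. ennreal (C - \<phi> x) \<partial>\<nu>')"
    if "\<nu>' \<in> invariant_measures M" for \<nu>'
  proof (rule extended_integral_eq)
    have s: "sets \<nu>' = sets (shift_borel M)" using that by (simp add: invariant_measures_def)
    show "\<phi> \<in> borel_measurable \<nu>'" using meas by (simp add: measurable_cong_sets[OF s refl])
    show "\<phi> x \<le> C" if "x \<in> space \<nu>'" for x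
      using that C(2) sets_eq_imp_space_eq[OF s] by (simp add: space_shift_borel)
  qed (use that C in \<open>auto simp: invariant_measures_def\<close>)
  define G where "G r = (\<integral>\<^sup>+x. ennreal (C - \<phi> x) \<partial>measure_pmf r)" for r
  have extG: "extended_integral (atomic_measure M r) \<phi> = ereal C - enn2ereal (G r)"
    if r: "invariant_pmf M r" for r
  proof -
    have "(\<integral>\<^sup>+x. ennreal (C - \<phi> x) \<partial>atomic_measure M r) = G r"
      unfolding G_def using r meas
      by (intro nn_integral_atomic_measure) (auto simp: invariant_pmf_def)
    thus ?thesis by (simp add: ext atomic_measure_invariant r)
  qed
  have Gfin: "G m < \<infinity>"
    using J unfolding extG[OF m] by (cases "G m") auto
  have P: "pressure M \<phi> = ereal C - enn2ereal (G m)"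
    using eqP by (simp add: measure_entropy_atomic_measure m extG)
  have upper: "measure_entropy \<nu>' shift + extended_integral \<nu>' \<phi> \<le> ereal C - enn2ereal (G m)"
    if "\<nu>' \<in> invariant_measures M" "extended_integral \<nu>' \<phi> > - \<infinity>" for \<nu>'
    unfolding P[symmetric] pressure_def using that by (intro SUP_upper) auto
  have Gle: "G m \<le> G r" if r: "invariant_pmf M r" for r
  proof (cases "G r = \<infinity>")
    case False
    then obtain g where g: "G r = ennreal g" "0 \<le> g" by (cases "G r") auto
    obtain g' where g': "G m = ennreal g'" "0 \<le> g'" using Gfin by (cases "G m") auto
    have "extended_integral (atomic_measure M r) \<phi> > - \<infinity>"
      by (simp add: extG[OF r] g enn2ereal_ennreal)
    from upper[OF atomic_measure_invariant[OF r] this]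
    show ?thesis using g g'
      by (simp add: measure_entropy_atomic_measure r extG enn2ereal_ennreal)
  qed simp
  have "G (if True then q else p) = G m"
    unfolding G_def
  proof (rule bind_pmf_nn_integral_minimal[where Q = "bernoulli_pmf \<epsilon>" and r = "\<lambda>b. if b then q else p"
        and j = True])
    show "True \<in> set_pmf (bernoulli_pmf \<epsilon>)" using \<epsilon> by simp
    show "(\<integral>\<^sup>+x. ennreal (C - \<phi> x) \<partial>measure_pmf (bind_pmf (bernoulli_pmf \<epsilon>) (\<lambda>b. if b then q else p)))
        = (\<integral>\<^sup>+x. ennreal (C - \<phi> x) \<partial>measure_pmf m)" by (simp only: m_def)
    show "(\<integral>\<^sup>+x. ennreal (C - \<phi> x) \<partial>measure_pmf m) \<le>
      (\<integral>\<^sup>+x. ennreal (C - \<phi> x) \<partial>measure_pmf (if b then q else p))" for b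
      using Gle[OF p] Gle[OF q] by (simp add: G_def)
    show "(\<integral>\<^sup>+x. ennreal (C - \<phi> x) \<partial>measure_pmf m) < \<infinity>" using Gfin by (simp add: G_def)
  qed
  hence Gq: "(\<integral>\<^sup>+x. ennreal (C - \<phi> x) \<partial>measure_pmf (bind_pmf Q \<rho>)) = G m" by (simp add: G_def q_def)
  have G\<rho>: "(\<integral>\<^sup>+x. ennreal (C - \<phi> x) \<partial>measure_pmf (\<rho> k)) = G m" for k
  proof (rule bind_pmf_nn_integral_minimal[OF _ Gq Gfin])
    show "G m \<le> (\<integral>\<^sup>+x. ennreal (C - \<phi> x) \<partial>measure_pmf (\<rho> j))" for j
      using Gle[OF \<rho>[of j]] by (simp add: G_def)
  qed (simp add: Q)
  have "continuous_on (shift_space M) (\<lambda>x. C - \<phi> x)" by (intro continuous_intros \<phi>(1))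
  from Fatou[OF this G\<rho>] have le: "(\<integral>\<^sup>+x. ennreal (C - \<phi> x) \<partial>\<nu>) \<le> G m" .
  obtain g' where g': "G m = ennreal g'" "0 \<le> g'" using Gfin by (cases "G m") auto
  obtain g where g: "(\<integral>\<^sup>+x. ennreal (C - \<phi> x) \<partial>\<nu>) = ennreal g" "0 \<le> g"
    using order_le_less_trans[OF le Gfin] by (cases "\<integral>\<^sup>+x. ennreal (C - \<phi> x) \<partial>\<nu>") auto
  have "g \<le> g'" using le g g' by simp
  have "extended_integral \<nu> \<phi> > - \<infinity>" by (simp add: ext[OF \<nu>] g enn2ereal_ennreal)
  from upper[OF \<nu> this] have "measure_entropy \<nu> shift + ereal (C - g) \<le> ereal (C - g')"
    using g g' by (simp add: ext[OF \<nu>] enn2ereal_ennreal)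
  thus False using h \<open>g \<le> g'\<close> by (cases "measure_entropy \<nu> shift") auto
qed

section \<open>Approximation by periodic orbits\<close>

text \<open>
  The first \<open>N\<close> letters of a sequence.
\<close>

definition initial_block :: "nat \<Rightarrow> (nat \<Rightarrow> nat) \<Rightarrow> nat list" where
  "initial_block N x = map x [0..<N]"

lemma length_initial_block [simp]: "length (initial_block N x) = N"
  by (simp add: initial_block_def)

lemma nth_initial_block [simp]: "i < N \<Longrightarrow> initial_block N x ! i = x i"
  by (simp add: initial_block_def)

lemma measurable_initial_block:
  "initial_block N \<in> measurable (shift_borel M) (count_space UNIV)"
proof (induction N)
  case 0
  show ?case by (simp add: initial_block_def[abs_def])
next
  case (Suc N)
  have "(\<lambda>x. initial_block N x @ [x N]) \<in> measurable (shift_borel M) (count_space UNIV)"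
    by (rule measurable_compose_countable[OF _ Suc, of "\<lambda>l x. l @ [x N]"])
       (rule measurable_compose[OF measurable_shift_borel_coordinate], simp)
  thus ?case by (simp add: initial_block_def[abs_def])
qed

lemma pmf_of_measure:
  fixes D :: "'a :: countable measure"
  assumes "prob_space D" and s: "sets D = UNIV"
  obtains E :: "'a pmf" where "measure_pmf E = D"
proof -
  interpret prob_space D by fact
  have "(\<integral>\<^sup>+x. ennreal (measure D {x}) \<partial>count_space UNIV) = emeasure D UNIV"
    unfolding emeasure_eq_measure[symmetric] using s
    by (intro emeasure_countable_singleton[symmetric]) auto
  also have "\<dots> = 1" using emeasure_space_1 sets_eq_imp_space_eq[of D "count_space UNIV"] s by simp
  finally have "pmf (embed_pmf (\<lambda>x. measure D {x})) x = measure D {x}" for x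
    by (intro pmf_embed_pmf) auto
  hence "measure_pmf (embed_pmf (\<lambda>x. measure D {x})) = D"
    using s by (intro measure_eqI_countable[of _ UNIV]) (auto simp: emeasure_pmf_single emeasure_eq_measure)
  thus thesis by (rule that)
qed

lemma tendsto_fun_if_eventually_eq:
  fixes y :: "'c \<Rightarrow> 'a \<Rightarrow> 'b :: topological_space"
  assumes "\<And>i. eventually (\<lambda>n. y n i = x i) F"
  shows "(y \<longlongrightarrow> x) F"
proof -
  have "limitin (product_topology (\<lambda>i :: 'a. euclidean) UNIV) y x F"
    unfolding limitin_componentwise using assms
    by (auto simp: limitin_canonical_iff intro: tendsto_eventually)
  thus ?thesis by (simp add: euclidean_product_topology limitin_canonical_iff)
qed

text \<open>
  One half of the weak convergence.  The infimum of \<open>f\<close> over the cylinder of length \<open>N\<close> around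
  \<open>x\<close> depends on the initial block only, hence has the same integral under \<open>m N\<close> and \<open>\<mu>\<close>; it lies
  below \<open>f\<close> and, by continuity, tends to \<open>f\<close> pointwise.
\<close>

lemma block_lower_bound:
  fixes f :: "(nat \<Rightarrow> nat) \<Rightarrow> real"
  assumes \<mu>: "prob_space \<mu>" "sets \<mu> = sets (shift_borel M)"
    and m: "\<And>N. prob_space (m N)" "\<And>N. sets (m N) = sets (shift_borel M)"
    and eq: "\<And>N. distr (m N) (count_space UNIV) (initial_block N) = distr \<mu> (count_space UNIV) (initial_block N)"
    and f: "continuous_on (shift_space M) f" "bounded (f ` shift_space M)"
  obtains a where "\<And>N. a N \<le> (\<integral>x. f x \<partial>m N)" and "a \<longlonglongrightarrow> (\<integral>x. f x \<partial>\<mu>)"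
proof -
  obtain B where B: "\<And>x. x \<in> shift_space M \<Longrightarrow> \<bar>f x\<bar> \<le> B" using f(2) by (auto simp: bounded_iff)
  define cyl where "cyl N w = {y \<in> shift_space M. initial_block N y = w}" for N w
  define g where "g N w = Inf (f ` cyl N w)" for N w
  define L where "L N x = g N (initial_block N x)" for N x
  have f_meas: "f \<in> borel_measurable (shift_borel M)"
    using f(1) by (rule continuous_on_shift_space_measurable)
  have bdd: "bdd_below (f ` cyl N w)" for N w
    using B by (intro bdd_belowI2[of _ "- B"]) (auto simp: cyl_def abs_le_iff minus_le_iff)
  have x_cyl: "x \<in> cyl N (initial_block N x)" if "x \<in> shift_space M" for x N
    using that by (simp add: cyl_def)
  have L_le: "L N x \<le> f x" if "x \<in> shift_space M" for N x
    unfolding L_def g_def using x_cyl[OF that] by (intro cInf_lower bdd) auto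
  have L_ge: "- B \<le> L N x" if "x \<in> shift_space M" for N x
    unfolding L_def g_def using x_cyl[OF that] B
    by (intro cInf_greatest) (auto simp: cyl_def abs_le_iff minus_le_iff)
  have L_bound: "\<bar>L N x\<bar> \<le> B" if "x \<in> shift_space M" for N x
    using L_le[OF that, of N] L_ge[OF that, of N] B[OF that] by auto
  have L_meas: "L N \<in> borel_measurable (shift_borel M)" for N
    unfolding L_def[abs_def] by (rule measurable_compose[OF measurable_initial_block]) simp
  have L_lim: "(\<lambda>N. L N x) \<longlonglongrightarrow> f x" if x: "x \<in> shift_space M" for x
  proof -
    have "\<exists>y \<in> cyl N (initial_block N x). f y < L N x + 1 / real (Suc N)" for N
      using cInf_lessD[of "f ` cyl N (initial_block N x)" "L N x + 1 / real (Suc N)"] x_cyl[OF x]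
      by (auto simp: L_def g_def)
    then obtain y where y: "\<And>N. y N \<in> cyl N (initial_block N x)"
      "\<And>N. f (y N) < L N x + 1 / real (Suc N)" by metis
    have "y \<longlonglongrightarrow> x"
    proof (rule tendsto_fun_if_eventually_eq)
      fix i
      show "eventually (\<lambda>N. y N i = x i) sequentially"
        using eventually_gt_at_top[of i]
      proof eventually_elim
        case (elim N)
        have "initial_block N (y N) ! i = initial_block N x ! i" using y(1)[of N] by (simp add: cyl_def)
        thus ?case using elim by simp
      qed
    qed
    hence fy: "(\<lambda>N. f (y N)) \<longlonglongrightarrow> f x"
      using f(1) x y(1) by (intro continuous_on_tendsto_compose[OF f(1)]) (auto simp: cyl_def)
    have "(\<lambda>N. f (y N) - 1 / real (Suc N)) \<longlonglongrightarrow> f x - 0"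
      by (intro tendsto_diff fy lim_1_over_n[THEN LIMSEQ_Suc])
    moreover have "f (y N) - 1 / real (Suc N) \<le> L N x" for N using y(2)[of N] by linarith
    ultimately show ?thesis using L_le[OF x]
      by (intro tendsto_sandwich[of "\<lambda>N. f (y N) - 1 / real (Suc N)" "\<lambda>N. L N x" _ "\<lambda>_. f x"]) auto
  qed
  define a where "a N = (\<integral>x. L N x \<partial>\<mu>)" for N
  have sp: "space \<mu> = shift_space M" "\<And>N. space (m N) = shift_space M"
    using sets_eq_imp_space_eq[OF \<mu>(2)] sets_eq_imp_space_eq[OF m(2)] by (auto simp: space_shift_borel)
  have lim: "a \<longlonglongrightarrow> (\<integral>x. f x \<partial>\<mu>)"
    unfolding a_def[abs_def]
  proof (rule integral_dominated_convergence[where w = "\<lambda>_. B"])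
    interpret prob_space \<mu> by fact
    show "f \<in> borel_measurable \<mu>" "\<And>N. L N \<in> borel_measurable \<mu>"
      using f_meas L_meas by (simp_all add: measurable_cong_sets[OF \<mu>(2) refl])
    show "integrable \<mu> (\<lambda>_. B)" by simp
    show "AE x in \<mu>. (\<lambda>N. L N x) \<longlonglongrightarrow> f x" using L_lim by (intro AE_I2) (simp add: sp)
    show "\<And>N. AE x in \<mu>. norm (L N x) \<le> B" using L_bound by (intro AE_I2) (simp add: sp)
  qed
  have "a N \<le> (\<integral>x. f x \<partial>m N)" for N
  proof -
    interpret mN: prob_space "m N" by (rule m)
    have "a N = (\<integral>w. g N w \<partial>distr \<mu> (count_space UNIV) (initial_block N))"
      unfolding a_def L_def using measurable_initial_block[of N M]
      by (subst integral_distr) (simp_all add: measurable_cong_sets[OF \<mu>(2) refl])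
    also have "\<dots> = (\<integral>x. L N x \<partial>m N)"
      unfolding eq[symmetric] L_def using measurable_initial_block[of N M]
      by (subst integral_distr) (simp_all add: measurable_cong_sets[OF m(2) refl])
    also have "\<dots> \<le> (\<integral>x. f x \<partial>m N)"
    proof (rule integral_mono)
      show "integrable (m N) (L N)" using L_bound L_meas
        by (intro mN.integrable_const_bound[where B = B] AE_I2) (simp_all add: sp measurable_cong_sets[OF m(2) refl])
      show "integrable (m N) f" using B f_meas
        by (intro mN.integrable_const_bound[where B = B] AE_I2) (simp_all add: sp measurable_cong_sets[OF m(2) refl])
    qed (use L_le in \<open>simp add: sp\<close>)
    finally show ?thesis .
  qed
  thus thesis using lim that by blast
qed

lemma block_laws_imp_weak_convergence:
  fixes f :: "(nat \<Rightarrow> nat) \<Rightarrow> real"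
  assumes "prob_space \<mu>" "sets \<mu> = sets (shift_borel M)"
    and "\<And>N. prob_space (m N)" "\<And>N. sets (m N) = sets (shift_borel M)"
    and "\<And>N. distr (m N) (count_space UNIV) (initial_block N) = distr \<mu> (count_space UNIV) (initial_block N)"
    and f: "continuous_on (shift_space M) f" "bounded (f ` shift_space M)"
  shows "(\<lambda>N. \<integral>x. f x \<partial>m N) \<longlonglongrightarrow> (\<integral>x. f x \<partial>\<mu>)"
proof -
  obtain a where a: "\<And>N. a N \<le> (\<integral>x. f x \<partial>m N)" "a \<longlonglongrightarrow> (\<integral>x. f x \<partial>\<mu>)"
    using block_lower_bound[OF assms] by blast
  have f': "continuous_on (shift_space M) (\<lambda>x. - f x)" "bounded ((\<lambda>x. - f x) ` shift_space M)"
    using f by (auto intro!: continuous_intros simp: bounded_iff)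
  obtain b where b: "\<And>N. b N \<le> (\<integral>x. - f x \<partial>m N)" "b \<longlonglongrightarrow> (\<integral>x. - f x \<partial>\<mu>)"
    using block_lower_bound[OF assms(1-5) f'] by blast
  have "(\<lambda>N. - b N) \<longlonglongrightarrow> (\<integral>x. f x \<partial>\<mu>)" using tendsto_minus[OF b(2)] by simp
  moreover have "(\<integral>x. f x \<partial>m N) \<le> - b N" for N using b(1)[of N] by simp
  ultimately show ?thesis
    using a by (intro tendsto_sandwich[of a "\<lambda>N. \<integral>x. f x \<partial>m N" sequentially "\<lambda>N. - b N"]) simp_all
qed

text \<open>
  A closed walk \<open>xs\<close> in the graph of \<open>N\<close>-blocks, read from position \<open>j\<close> on, as the periodic
  sequence of the first letters of its blocks.
\<close>
definition cyclic_point :: "nat list list \<Rightarrow> nat \<Rightarrow> nat \<Rightarrow> nat" where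
  "cyclic_point xs j = (\<lambda>i. hd (xs ! ((j + i) mod length xs)))"

lemma shift_cyclic_point: "shift (cyclic_point xs j) = cyclic_point xs (Suc j mod length xs)"
  by (simp add: shift_def cyclic_point_def mod_simps)

text \<open>
  The joint law of the blocks of \<open>x\<close> and \<open>shift x\<close> is balanced by invariance, and its cycle
  decomposition turns into a mixture of periodic orbits.
\<close>

lemma exists_invariant_pmf_with_block_law:
  assumes \<mu>: "\<mu> \<in> invariant_measures M" and N: "0 < N"
  obtains p where "invariant_pmf M p"
    and "distr (atomic_measure M p) (count_space UNIV) (initial_block N) = distr \<mu> (count_space UNIV) (initial_block N)"
proof -
  have s: "sets \<mu> = sets (shift_borel M)" and inv: "distr \<mu> \<mu> shift = \<mu>" and "prob_space \<mu>"
    using \<mu> by (auto simp: invariant_measures_def)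
  interpret prob_space \<mu> by fact
  have sp: "space \<mu> = shift_space M"
    using sets_eq_imp_space_eq[OF s] by (simp add: space_shift_borel)
  have blk: "initial_block N \<in> measurable \<mu> (count_space UNIV)"
    using measurable_initial_block[of N M] by (simp add: measurable_cong_sets[OF s refl])
  have sh: "shift \<in> measurable \<mu> \<mu>"
    using measurable_shift[of M] by (simp add: measurable_cong_sets[OF s s])
  have blk': "(\<lambda>x. initial_block N (shift x)) \<in> measurable \<mu> (count_space UNIV)"
    by (rule measurable_compose[OF sh blk])
  define e where "e x = (initial_block N x, initial_block N (shift x))" for x
  have e: "e \<in> measurable \<mu> (count_space UNIV)"
    unfolding e_def[abs_def]
    by (rule measurable_compose_countable[OF _ blk, of "\<lambda>u x. (u, initial_block N (shift x))"])
       (rule measurable_compose[OF blk'], simp)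
  obtain E where E: "measure_pmf E = distr \<mu> (count_space UNIV) e"
    by (rule pmf_of_measure[of "distr \<mu> (count_space UNIV) e"]) (use e in \<open>auto intro: prob_space_distr\<close>)
  have fstE: "measure_pmf (map_pmf fst E) = distr \<mu> (count_space UNIV) (initial_block N)"
    unfolding map_pmf_rep_eq E
    by (subst distr_distr[OF _ e]) (simp_all add: e_def comp_def)
  have "measure_pmf (map_pmf snd E) = distr \<mu> (count_space UNIV) (initial_block N \<circ> shift)"
    unfolding map_pmf_rep_eq E
    by (subst distr_distr[OF _ e]) (simp_all add: e_def comp_def)
  also have "\<dots> = distr (distr \<mu> \<mu> shift) (count_space UNIV) (initial_block N)"
    by (rule distr_distr[OF blk sh, symmetric])
  also have "\<dots> = measure_pmf (map_pmf fst E)" by (simp add: inv fstE)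
  finally have "map_pmf fst E = map_pmf snd E" by (simp add: measure_pmf_inject)
  then obtain C where C: "[] \<notin> set_pmf C" "E = bind_pmf C closed_walk_pmf"
    by (rule balanced_pmf_cycle_decomposition)
  have setE: "\<exists>x\<in>shift_space M. uv = e x" if "uv \<in> set_pmf E" for uv
  proof (rule ccontr)
    assume "\<not> ?thesis"
    hence empty: "e -` {uv} \<inter> space \<mu> = {}" unfolding sp by blast
    hence "emeasure (measure_pmf E) {uv} = 0" unfolding E using e empty by (simp add: emeasure_distr)
    thus False using that by (simp add: emeasure_pmf_single set_pmf_eq)
  qed
  have edge: "\<exists>x\<in>shift_space M. xs ! j = initial_block N x \<and> xs ! (Suc j mod length xs) = initial_block N (shift x)"
    if xs: "xs \<in> set_pmf C" and j: "j < length xs" for xs j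
  proof -
    have "(xs ! j, xs ! (Suc j mod length xs)) \<in> set_pmf (closed_walk_pmf xs)"
      using xs C(1) j by (subst set_closed_walk_pmf) auto
    hence "(xs ! j, xs ! (Suc j mod length xs)) \<in> set_pmf E" using xs by (auto simp: C(2))
    thus ?thesis using setE by (force simp: e_def)
  qed
  \<comment> \<open>Consecutive blocks overlap in all but one letter, so a closed walk is recovered from its first letters.\<close>
  have block: "initial_block N (cyclic_point xs j) = xs ! j"
    if xs: "xs \<in> set_pmf C" and j: "j < length xs" for xs j
  proof -
    have "xs ! j ! i = cyclic_point xs j i" if "i < N" for i
      using j that
    proof (induction i arbitrary: j)
      case 0
      obtain x where "xs ! j = initial_block N x" using edge[OF xs \<open>j < length xs\<close>] by blast
      thus ?case using 0 by (simp add: cyclic_point_def hd_conv_nth initial_block_def)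
    next
      case (Suc i)
      obtain x where x: "xs ! j = initial_block N x" "xs ! (Suc j mod length xs) = initial_block N (shift x)"
        using edge[OF xs Suc.prems(1)] by blast
      have "xs ! j ! Suc i = xs ! (Suc j mod length xs) ! i" using Suc.prems x by (simp add: shift_def)
      also have "\<dots> = cyclic_point xs (Suc j mod length xs) i"
      proof (rule Suc.IH)
        have "0 < length xs" using Suc.prems by linarith
        thus "Suc j mod length xs < length xs" by simp
      qed (use Suc.prems in simp)
      also have "\<dots> = cyclic_point xs j (Suc i)"
        using fun_cong[OF shift_cyclic_point[of xs j], of i] by (simp add: shift_def)
      finally show ?case .
    qed
    moreover have "length (xs ! j) = N"
    proof -
      obtain x where "xs ! j = initial_block N x" using edge[OF xs j] by blast
      thus ?thesis by simp
    qed
    ultimately show ?thesis by (intro nth_equalityI) auto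
  qed
  have adm: "cyclic_point xs j \<in> shift_space M" if xs: "xs \<in> set_pmf C" and j: "j < length xs" for xs j
    unfolding shift_space_def
  proof (clarify)
    fix i
    have l: "0 < length xs" using j by linarith
    let ?k = "(j + i) mod length xs"
    obtain x where x: "x \<in> shift_space M" "xs ! ?k = initial_block N x"
        "xs ! (Suc ?k mod length xs) = initial_block N (shift x)"
      using edge[OF xs, of ?k] l by auto
    have "hd (initial_block N y) = y 0" for y using N by (simp add: initial_block_def hd_map)
    hence "cyclic_point xs j i = x 0" "cyclic_point xs j (Suc i) = x 1"
      using x by (simp_all add: cyclic_point_def mod_simps shift_def)
    thus "M (cyclic_point xs j i) (cyclic_point xs j (Suc i)) = 1"
      using x(1) by (simp add: shift_space_def)
  qed
  define p where "p = bind_pmf C (\<lambda>xs. map_pmf (cyclic_point xs) (pmf_of_set {..<length xs}))"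
  have p: "invariant_pmf M p"
    unfolding p_def
  proof (rule invariant_pmf_bind)
    fix xs assume xs: "xs \<in> set_pmf C"
    hence l: "0 < length xs" using C(1) by auto
    have "map_pmf shift (map_pmf (cyclic_point xs) (pmf_of_set {..<length xs})) =
      map_pmf (cyclic_point xs) (map_pmf (\<lambda>j. Suc j mod length xs) (pmf_of_set {..<length xs}))"
      by (simp add: map_pmf_comp shift_cyclic_point)
    also have "\<dots> = map_pmf (cyclic_point xs) (pmf_of_set {..<length xs})" by (simp only: map_pmf_rotate[OF l])
    finally show "invariant_pmf M (map_pmf (cyclic_point xs) (pmf_of_set {..<length xs}))"
      using adm[OF xs] l by (auto simp: invariant_pmf_def lessThan_empty_iff)
  qed
  have "map_pmf (initial_block N) p = bind_pmf C (\<lambda>xs. map_pmf fst (closed_walk_pmf xs))"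
    unfolding p_def map_bind_pmf
  proof (rule bind_pmf_cong[OF refl])
    fix xs assume xs: "xs \<in> set_pmf C"
    hence l: "0 < length xs" using C(1) by auto
    show "map_pmf (initial_block N) (map_pmf (cyclic_point xs) (pmf_of_set {..<length xs})) = map_pmf fst (closed_walk_pmf xs)"
      unfolding closed_walk_pmf_def map_pmf_comp
      using block[OF xs] l by (intro map_pmf_cong) (auto simp: lessThan_empty_iff)
  qed
  also have "\<dots> = map_pmf fst E" by (simp add: C(2) map_bind_pmf)
  finally have mp: "map_pmf (initial_block N) p = map_pmf fst E" .
  have "distr (atomic_measure M p) (count_space UNIV) (initial_block N) = measure_pmf (map_pmf (initial_block N) p)"
  proof (rule measure_eqI)
    fix A :: "nat list set"
    have mb: "initial_block N \<in> measurable (atomic_measure M p) (count_space UNIV)"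
      using measurable_initial_block[of N M] by (simp add: measurable_cong_sets[OF sets_atomic_measure refl])
    have sub: "set_pmf p \<subseteq> shift_space M" using p by (simp add: invariant_pmf_def)
    have S: "initial_block N -` A \<inter> shift_space M \<in> sets (shift_borel M)"
      using measurable_sets[OF measurable_initial_block, of A N M] by (simp add: space_shift_borel)
    have "emeasure (distr (atomic_measure M p) (count_space UNIV) (initial_block N)) A =
      emeasure (measure_pmf p) (initial_block N -` A \<inter> shift_space M)"
      using mb S sub by (simp add: emeasure_distr space_atomic_measure emeasure_atomic_measure)
    also have "\<dots> = emeasure (measure_pmf p) (initial_block N -` A)"
      using sub by (intro emeasure_eq_AE) (auto simp: AE_measure_pmf_iff)
    finally show "emeasure (distr (atomic_measure M p) (count_space UNIV) (initial_block N)) A =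
       emeasure (measure_pmf (map_pmf (initial_block N) p)) A" by simp
  qed simp
  thus thesis using that[OF p] by (simp add: mp fstE)
qed

section \<open>Loops and random bits\<close>

text \<open>
  A loop at \<open>a\<close> is a nonempty word that starts with \<open>a\<close> and can be followed by \<open>a\<close>; the
  return to \<open>a\<close> itself is not part of the word.
\<close>

definition loop_at :: "(nat \<Rightarrow> nat \<Rightarrow> nat) \<Rightarrow> nat \<Rightarrow> nat list \<Rightarrow> bool" where
  "loop_at M a w \<longleftrightarrow> w \<noteq> [] \<and> hd w = a \<and> admissible_word M (w @ [a])"

lemma admissible_word_successively: "admissible_word M w \<longleftrightarrow> successively (\<lambda>a b. M a b = 1) w"
  by (auto simp: admissible_word_def successively_conv_nth)

lemma admissible_word_append:
  "admissible_word M (u @ [a]) \<Longrightarrow> admissible_word M (a # v) \<Longrightarrow> admissible_word M (u @ a # v)"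
  by (auto simp: admissible_word_successively successively_append_iff)

lemma loop_at_append:
  assumes "loop_at M a u" "loop_at M a v"
  shows "loop_at M a (u @ v)"
proof -
  obtain v' where v': "v = a # v'" using assms(2) by (cases v) (auto simp: loop_at_def)
  have "admissible_word M (u @ a # (v' @ [a]))"
  proof (rule admissible_word_append)
    show "admissible_word M (u @ [a])" using assms(1) by (simp add: loop_at_def)
    show "admissible_word M (a # (v' @ [a]))" using assms(2) by (simp add: loop_at_def v')
  qed
  moreover have "u \<noteq> []" "hd u = a" using assms(1) by (simp_all add: loop_at_def)
  ultimately show ?thesis by (simp add: loop_at_def v')
qed

lemma loop_through:
  assumes "transitive_shift M" "a \<noteq> b"
  obtains w where "loop_at M a w" "b \<in> set w"
proof -
  obtain p where p: "p \<noteq> []" "admissible_word M p" "hd p = a" "last p = b"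
    using assms(1) by (auto simp: transitive_shift_def)
  obtain q where q: "q \<noteq> []" "admissible_word M q" "hd q = b" "last q = a"
    using assms(1) by (auto simp: transitive_shift_def)
  obtain p' where p': "p = p' @ [b]" using p by (metis append_butlast_last_id)
  have "p' \<noteq> []" using p p' assms(2) by auto
  obtain q' where q': "q = b # q'" using q by (cases q) auto
  have "q' \<noteq> []" using q q' assms(2) by auto
  have pq: "admissible_word M (p' @ q)"
    unfolding q' by (rule admissible_word_append) (use p p' q q' in auto)
  have "p' @ q = (p' @ butlast q) @ [a]" using q by (metis append_assoc append_butlast_last_id)
  moreover have "hd (p' @ butlast q) = a" using p p' \<open>p' \<noteq> []\<close> by simp
  moreover have "b \<in> set (p' @ butlast q)" using \<open>q' \<noteq> []\<close> by (simp add: q')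
  ultimately show thesis using pq \<open>p' \<noteq> []\<close> by (intro that[of "p' @ butlast q"]) (auto simp: loop_at_def)
qed

text \<open>
  Two loops at \<open>a\<close> of the same length \<open>L\<close> that differ at position \<open>d\<close>.
\<close>

locale horseshoe =
  fixes M :: "nat \<Rightarrow> nat \<Rightarrow> nat" and a L d :: nat and U V :: "nat list"
  assumes loops: "loop_at M a U" "loop_at M a V" and len: "length U = L" "length V = L"
    and d: "d < L" and differ: "U ! d \<noteq> V ! d"

text \<open>
  Take a loop \<open>u\<close> and a loop \<open>v\<close> through a letter that does not occur in \<open>u\<close>; this is where the
  alphabet being infinite is used.  The words \<open>uv\<close> and \<open>vu\<close> have equal length, and they are distinct
  because commuting nonempty words are powers of a common word and so use the same letters.
\<close>

lemma transitive_imp_horseshoe: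
  assumes "transitive_shift M"
  obtains L d U V where "horseshoe M 0 L d U V"
proof -
  obtain u where u: "loop_at M 0 u" using loop_through[OF assms, of 0 1] by auto
  obtain b where b: "b \<notin> set u" using ex_new_if_finite[of "set u"] by auto
  have "0 \<in> set u" using u hd_in_set[of u] by (simp add: loop_at_def)
  with b have "0 \<noteq> b" by metis
  then obtain v where v: "loop_at M 0 v" "b \<in> set v" using loop_through[OF assms] by blast
  have "u @ v \<noteq> v @ u"
  proof
    assume "u @ v = v @ u"
    then obtain m n zs where *: "concat (replicate m zs) = u" "concat (replicate n zs) = v"
      using comm_append_are_replicate by blast
    have "m \<noteq> 0" using u *(1) by (auto simp: loop_at_def)
    hence "set zs \<subseteq> set u" unfolding *(1)[symmetric] by auto
    moreover have "set v \<subseteq> set zs" unfolding *(2)[symmetric] by (auto split: if_splits)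
    ultimately show False using v(2) b by blast
  qed
  moreover have "length (u @ v) = length (v @ u)" by simp
  ultimately obtain d where "d < length (u @ v)" "(u @ v) ! d \<noteq> (v @ u) ! d"
    using nth_equalityI[of "u @ v" "v @ u"] by blast
  thus thesis
    using u v(1) by (intro that[of "length (u @ v)" d "u @ v" "v @ u"] horseshoe.intro loop_at_append) simp_all
qed

text \<open>
  The Bernoulli measure of independent fair coin tosses.
\<close>

definition fair_bits :: "(nat \<Rightarrow> bool) measure" where
  "fair_bits = PiM UNIV (\<lambda>_. measure_pmf (bernoulli_pmf (1 / 2)))"

interpretation fair_bits: product_prob_space "\<lambda>_ :: nat. measure_pmf (bernoulli_pmf (1 / 2))" UNIV
  by unfold_locales

lemma prob_space_fair_bits: "prob_space fair_bits"
  unfolding fair_bits_def by unfold_locales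

lemma space_fair_bits [simp]: "space fair_bits = UNIV"
  by (simp add: fair_bits_def space_PiM)

lemma measurable_fair_bits_coordinate:
  "(\<lambda>\<omega>. \<omega> i) \<in> measurable fair_bits (count_space UNIV)"
proof -
  have "(\<lambda>\<omega>. \<omega> i) \<in> measurable fair_bits (measure_pmf (bernoulli_pmf (1 / 2)))"
    unfolding fair_bits_def by (rule measurable_component_singleton) simp
  thus ?thesis by (simp add: measurable_cong_sets[OF refl sets_measure_pmf_count_space])
qed

lemma emeasure_fair_bits_cylinder:
  assumes "finite J"
  shows "emeasure fair_bits {\<omega>. \<forall>j\<in>J. \<omega> j = s j} = ennreal ((1 / 2) ^ card J)"
proof -
  have "emeasure fair_bits {\<omega>. \<forall>j\<in>J. \<omega> j = s j} = (\<Prod>j\<in>J. emeasure (measure_pmf (bernoulli_pmf (1 / 2))) {s j})"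
    using fair_bits.emeasure_PiM_Collect[of J "\<lambda>j. {s j}"] assms
    by (simp add: fair_bits_def space_PiM)
  also have "\<dots> = (\<Prod>j\<in>J. ennreal (1 / 2))"
  proof (rule prod.cong)
    fix j show "emeasure (measure_pmf (bernoulli_pmf (1 / 2))) {s j} = ennreal (1 / 2)"
      by (cases "s j") (simp_all add: emeasure_pmf_single)
  qed simp
  also have "\<dots> = ennreal ((1 / 2) ^ card J)"
    by (simp only: prod_constant) (rule ennreal_power, simp)
  finally show ?thesis .
qed

lemma sets_fair_bits_cylinder:
  assumes "finite J"
  shows "{\<omega>. \<forall>j\<in>J. \<omega> j = s j} \<in> sets fair_bits"
proof -
  have "{\<omega>. \<forall>j\<in>J. \<omega> j = s j} = space fair_bits \<inter> (\<Inter>j\<in>J. (\<lambda>\<omega>. \<omega> j) -` {s j} \<inter> space fair_bits)" by auto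
  also have "\<dots> \<in> sets fair_bits"
  proof (cases "J = {}")
    case False
    have "(\<lambda>\<omega>. \<omega> j) -` {s j} \<inter> space fair_bits \<in> sets fair_bits" for j
      by (rule measurable_sets[OF measurable_fair_bits_coordinate]) simp
    thus ?thesis using assms False by (intro sets.Int[OF sets.top] sets.finite_INT)
  qed (use sets.top[of fair_bits] in simp)
  finally show ?thesis .
qed

lemma fair_bits_shift: "distr fair_bits fair_bits (\<lambda>\<omega> i. \<omega> (Suc i)) = fair_bits"
proof -
  have "distr (PiM UNIV (\<lambda>_ :: nat. measure_pmf (bernoulli_pmf (1 / 2))))
     (PiM UNIV (\<lambda>_ :: nat. measure_pmf (bernoulli_pmf (1 / 2)))) (\<lambda>\<omega>. \<lambda>n\<in>UNIV. \<omega> (Suc n)) =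
    PiM UNIV (\<lambda>_ :: nat. measure_pmf (bernoulli_pmf (1 / 2)))"
    by (rule distr_PiM_reindex) (simp_all add: prob_space_measure_pmf)
  thus ?thesis by (simp add: fair_bits_def restrict_UNIV)
qed

text \<open>
  The bit sequences with period \<open>n\<close>, not necessarily minimal.
\<close>

definition periodic_bits :: "nat \<Rightarrow> (nat \<Rightarrow> bool) set" where
  "periodic_bits n = {\<omega>. \<forall>i. \<omega> (i + n) = \<omega> i}"

lemma periodic_bits_mod:
  assumes "\<omega> \<in> periodic_bits n"
  shows "\<omega> (i mod n) = \<omega> i"
proof -
  have "\<omega> (j + m * n) = \<omega> j" for j m
  proof (induction m)
    case (Suc m)
    have "\<omega> (j + m * n + n) = \<omega> (j + m * n)" using assms by (simp add: periodic_bits_def)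
    thus ?case using Suc by (simp add: algebra_simps)
  qed simp
  from this[of "i mod n" "i div n"] show ?thesis by simp
qed

lemma mod_in_periodic_bits: "(\<lambda>i. \<omega> (i mod n)) \<in> periodic_bits n"
  by (simp add: periodic_bits_def)

lemma finite_periodic_bits:
  assumes "0 < n"
  shows "finite (periodic_bits n)"
proof (rule finite_surj[OF finite_lists_length_eq[of UNIV n]])
  show "periodic_bits n \<subseteq> (\<lambda>l i. l ! (i mod n)) ` {xs. set xs \<subseteq> UNIV \<and> length xs = n}"
  proof
    fix \<omega> assume \<omega>: "\<omega> \<in> periodic_bits n"
    hence "\<omega> = (\<lambda>i. map \<omega> [0..<n] ! (i mod n))" using assms periodic_bits_mod[OF \<omega>] by auto
    thus "\<omega> \<in> (\<lambda>l i. l ! (i mod n)) ` {xs. set xs \<subseteq> UNIV \<and> length xs = n}"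
      by (intro image_eqI[of _ _ "map \<omega> [0..<n]"]) auto
  qed
qed simp

lemma map_pmf_shift_periodic_bits:
  assumes "0 < n"
  shows "map_pmf (\<lambda>\<omega> i. \<omega> (Suc i)) (pmf_of_set (periodic_bits n)) = pmf_of_set (periodic_bits n)"
proof (rule map_pmf_of_set_bij_betw)
  let ?S = "\<lambda>\<omega> i. \<omega> (Suc i) :: bool"
  have inj: "inj_on ?S (periodic_bits n)"
  proof (rule inj_onI, rule ext)
    fix \<omega> \<omega>' :: "nat \<Rightarrow> bool" and i
    assume *: "\<omega> \<in> periodic_bits n" "\<omega>' \<in> periodic_bits n" "?S \<omega> = ?S \<omega>'"
    obtain m where n: "n = Suc m" using assms by (cases n) auto
    have "\<omega> i = ?S \<omega> (i + m)" "\<omega>' i = ?S \<omega>' (i + m)" using *(1,2) by (simp_all add: periodic_bits_def n)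
    thus "\<omega> i = \<omega>' i" using fun_cong[OF *(3), of "i + m"] by simp
  qed
  have "?S ` periodic_bits n \<subseteq> periodic_bits n"
  proof (rule image_subsetI)
    fix \<omega> assume "\<omega> \<in> periodic_bits n"
    hence "\<omega> (Suc i + n) = \<omega> (Suc i)" for i unfolding periodic_bits_def by blast
    thus "?S \<omega> \<in> periodic_bits n" by (simp add: periodic_bits_def)
  qed
  with inj show "bij_betw ?S (periodic_bits n) (periodic_bits n)"
    using endo_inj_surj[OF finite_periodic_bits[OF assms]] by (simp add: bij_betw_def)
qed (use finite_periodic_bits[OF assms] mod_in_periodic_bits in auto)

text \<open>
  Repeating the first \<open>n\<close> fair bits periodically yields a uniformly distributed \<open>n\<close>-periodic
  sequence.
\<close>

lemma nn_integral_fair_bits_periodize: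
  assumes n: "0 < n"
  shows "(\<integral>\<^sup>+\<omega>. h (\<lambda>i. \<omega> (i mod n)) \<partial>fair_bits) = (\<integral>\<^sup>+\<omega>. h \<omega> \<partial>measure_pmf (pmf_of_set (periodic_bits n)))"
proof -
  let ?X = "periodic_bits n" and ?c = "ennreal ((1 / 2) ^ n)"
  let ?Z = "\<lambda>x. {\<omega>. \<forall>j\<in>{..<n}. \<omega> j = x j}"
  have fin: "finite ?X" by (rule finite_periodic_bits[OF n])
  have ne: "?X \<noteq> {}" using mod_in_periodic_bits by blast
  have sum: "(\<integral>\<^sup>+\<omega>. g (\<lambda>i. \<omega> (i mod n)) \<partial>fair_bits) = (\<Sum>x\<in>?X. g x) * ?c" for g :: "(nat \<Rightarrow> bool) \<Rightarrow> ennreal"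
  proof -
    have iff: "\<omega> \<in> ?Z x \<longleftrightarrow> x = (\<lambda>i. \<omega> (i mod n))" if x: "x \<in> ?X" for x \<omega>
    proof
      assume "\<omega> \<in> ?Z x"
      hence "x i = \<omega> (i mod n)" for i using periodic_bits_mod[OF x, of i] n by simp
      thus "x = (\<lambda>i. \<omega> (i mod n))" by blast
    qed simp
    have "g (\<lambda>i. \<omega> (i mod n)) = (\<Sum>x\<in>?X. g x * indicator (?Z x) \<omega>)" for \<omega>
    proof -
      have "(\<Sum>x\<in>?X. g x * indicator (?Z x) \<omega>) = (\<Sum>x\<in>?X. if x = (\<lambda>i. \<omega> (i mod n)) then g x else 0)"
        by (intro sum.cong refl) (simp only: indicator_def of_bool_def iff, simp)
      also have "\<dots> = g (\<lambda>i. \<omega> (i mod n))" using fin mod_in_periodic_bits[of \<omega> n] by (simp add: sum.delta')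
      finally show ?thesis ..
    qed
    hence "(\<integral>\<^sup>+\<omega>. g (\<lambda>i. \<omega> (i mod n)) \<partial>fair_bits) = (\<integral>\<^sup>+\<omega>. (\<Sum>x\<in>?X. g x * indicator (?Z x) \<omega>) \<partial>fair_bits)" by simp
    also have "\<dots> = (\<Sum>x\<in>?X. \<integral>\<^sup>+\<omega>. g x * indicator (?Z x) \<omega> \<partial>fair_bits)"
      by (intro nn_integral_sum borel_measurable_times_ennreal borel_measurable_const
           borel_measurable_indicator sets_fair_bits_cylinder) simp
    also have "\<dots> = (\<Sum>x\<in>?X. g x * ?c)"
      by (intro sum.cong refl)
         (simp add: nn_integral_cmult_indicator sets_fair_bits_cylinder emeasure_fair_bits_cylinder del: lessThan_iff)
    finally show ?thesis by (simp add: sum_distrib_right)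
  qed
  interpret prob_space fair_bits by (rule prob_space_fair_bits)
  have "1 = ennreal (real (card ?X)) * ?c" using sum[of "\<lambda>_. 1"] emeasure_space_1 by (simp add: ennreal_of_nat_eq_real_of_nat)
  also have "\<dots> = ennreal (real (card ?X) * (1 / 2) ^ n)" by (simp add: ennreal_mult)
  finally have "real (card ?X) * (1 / 2) ^ n = 1" by simp
  hence c: "?c = inverse (ennreal (real (card ?X)))"
    using fin ne by (subst inverse_ennreal) (auto simp: field_simps card_gt_0_iff)
  show ?thesis
    unfolding sum c using fin ne
    by (simp add: nn_integral_pmf_of_set divide_ennreal_def ennreal_of_nat_eq_real_of_nat)
qed

section \<open>A horseshoe of positive entropy\<close>

lemma loop_at_nth:
  assumes "loop_at M a w"
  shows "w ! 0 = a" and "Suc k < length w \<Longrightarrow> M (w ! k) (w ! Suc k) = 1"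
    and "M (w ! (length w - 1)) a = 1"
proof -
  have w: "w \<noteq> []" "hd w = a"
    and adm: "\<And>i. Suc i < length (w @ [a]) \<Longrightarrow> M ((w @ [a]) ! i) ((w @ [a]) ! Suc i) = 1"
    using assms unfolding loop_at_def admissible_word_def by blast+
  show "w ! 0 = a" using w by (simp add: hd_conv_nth)
  show "M (w ! k) (w ! Suc k) = 1" if "Suc k < length w"
    using adm[of k] that by (simp add: nth_append)
  have "Suc (length w - 1) = length w" using w(1) by simp
  thus "M (w ! (length w - 1)) a = 1"
    using adm[of "length w - 1"] by (simp add: nth_append)
qed

context horseshoe begin

lemma L_pos: "0 < L" using d by simp

text \<open>
  The concatenation of the loops \<open>U\<close> and \<open>V\<close> selected by the bits of \<open>\<omega>\<close>, read from position \<open>j\<close> on.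
\<close>

definition phase :: "nat \<Rightarrow> (nat \<Rightarrow> bool) \<Rightarrow> nat \<Rightarrow> nat" where
  "phase j \<omega> i = (if \<omega> ((i + j) div L) then U else V) ! ((i + j) mod L)"

lemma shift_phase: "shift (phase j \<omega>) = phase (Suc j) \<omega>"
  by (simp add: shift_def phase_def fun_eq_iff)

lemma shift_funpow: "(shift ^^ n) x i = x (i + n)"
  by (induction n arbitrary: i) (simp_all add: shift_def)

lemma phase_L: "phase L \<omega> = phase 0 (\<lambda>i. \<omega> (Suc i))"
  using L_pos by (simp add: phase_def fun_eq_iff)

lemma phase_in_shift_space: "phase j \<omega> \<in> shift_space M"
  unfolding shift_space_def
proof (clarify)
  fix i
  let ?n = "i + j"
  let ?W = "\<lambda>b. if b then U else V"
  have W: "loop_at M a (?W b)" "length (?W b) = L" for b using loops len by auto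
  have step: "M (?W b ! k) (?W b ! Suc k) = 1" if "Suc k < L" for b k
    using loop_at_nth(2)[OF W(1)[of b], of k] that unfolding W(2) by blast
  have last: "M (?W b ! (L - 1)) (?W c ! 0) = 1" for b c
    using loop_at_nth(3)[OF W(1)[of b]] loop_at_nth(1)[OF W(1)[of c]] unfolding W(2) by metis
  show "M (phase j \<omega> i) (phase j \<omega> (Suc i)) = 1"
  proof (cases "Suc (?n mod L) = L")
    case True
    hence "Suc ?n mod L = 0" "?n mod L = L - 1" by (simp_all add: mod_Suc)
    thus ?thesis using last by (simp add: phase_def)
  next
    case False
    hence "Suc (?n mod L) < L" using mod_less_divisor[OF L_pos, of ?n] by linarith
    moreover have "Suc ?n mod L = Suc (?n mod L)" "Suc ?n div L = ?n div L"
      using False by (simp_all add: mod_Suc div_Suc)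
    ultimately show ?thesis using step by (simp add: phase_def)
  qed
qed

lemma measurable_phase:
  "(\<lambda>\<omega>. phase j (\<lambda>i. \<omega> (r i))) \<in> measurable fair_bits (shift_borel M)"
proof (rule measurable_shift_borelI)
  fix i
  have "(\<lambda>\<omega>. (\<lambda>b. (if b then U else V) ! ((i + j) mod L)) (\<omega> (r ((i + j) div L)))) \<in> measurable fair_bits (count_space UNIV)"
    by (rule measurable_compose[OF measurable_fair_bits_coordinate]) simp
  thus "(\<lambda>\<omega>. phase j (\<lambda>i. \<omega> (r i)) i) \<in> measurable fair_bits (count_space UNIV)"
    by (simp add: phase_def)
qed (rule phase_in_shift_space)

text \<open>
  Shifting moves each level of the tower to the next one; if level \<open>L\<close> contributes the same as
  the base, the sum over the levels does not change.
\<close>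

lemma sum_phase_shift:
  fixes g :: "nat \<Rightarrow> ennreal"
  assumes "g L = g 0"
  shows "(\<Sum>j<L. g (Suc j)) = (\<Sum>j<L. g j)"
proof -
  obtain l where l: "L = Suc l" using L_pos by (cases L) auto
  show ?thesis using assms unfolding l
    by (subst (2) sum.lessThan_Suc_shift) (simp add: add.commute)
qed

text \<open>
  The law of \<open>phase j \<omega>\<close> for independent uniform \<open>j < L\<close> and fair bits \<open>\<omega>\<close>.
\<close>

definition tower_measure :: "(nat \<Rightarrow> nat) measure" where
  "tower_measure = distr (measure_pmf (pmf_of_set {..<L}) \<Otimes>\<^sub>M fair_bits) (shift_borel M) (\<lambda>(j, \<omega>). phase j \<omega>)"

lemma sets_tower_measure: "sets tower_measure = sets (shift_borel M)"
  by (simp add: tower_measure_def)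

lemma space_tower_measure: "space tower_measure = shift_space M"
  by (simp add: tower_measure_def space_shift_borel)

lemma measurable_phase_pair:
  "(\<lambda>(j, \<omega>). phase j \<omega>) \<in> measurable (measure_pmf (pmf_of_set {..<L}) \<Otimes>\<^sub>M fair_bits) (shift_borel M)"
proof -
  have "(\<lambda>(j, \<omega>). phase j \<omega>) \<in> measurable (count_space UNIV \<Otimes>\<^sub>M fair_bits) (shift_borel M)"
    using measurable_phase[of _ "\<lambda>i. i"] by (intro measurable_pair_measure_countable1) auto
  thus ?thesis
    by (simp add: measurable_cong_sets[OF sets_pair_measure_cong[OF sets_measure_pmf_count_space refl] refl])
qed

lemma nn_integral_tower_measure:
  assumes f: "f \<in> borel_measurable (shift_borel M)"
  shows "(\<integral>\<^sup>+x. f x \<partial>tower_measure) = inverse (of_nat L) * (\<Sum>j<L. \<integral>\<^sup>+\<omega>. f (phase j \<omega>) \<partial>fair_bits)"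
proof -
  interpret prob_space fair_bits by (rule prob_space_fair_bits)
  have "(\<integral>\<^sup>+x. f x \<partial>tower_measure) =
    (\<integral>\<^sup>+z. f (case z of (j, \<omega>) \<Rightarrow> phase j \<omega>) \<partial>(measure_pmf (pmf_of_set {..<L}) \<Otimes>\<^sub>M fair_bits))"
    unfolding tower_measure_def using f by (simp add: nn_integral_distr measurable_phase_pair)
  also have "\<dots> = (\<integral>\<^sup>+j. \<integral>\<^sup>+\<omega>. f (phase j \<omega>) \<partial>fair_bits \<partial>measure_pmf (pmf_of_set {..<L}))"
    by (subst nn_integral_fst[symmetric]) (use measurable_compose[OF measurable_phase_pair f] in simp_all)
  also have "\<dots> = inverse (of_nat L) * (\<Sum>j<L. \<integral>\<^sup>+\<omega>. f (phase j \<omega>) \<partial>fair_bits)"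
    using L_pos by (subst nn_integral_pmf_of_set)
      (auto simp: divide_ennreal_def lessThan_empty_iff mult.commute ennreal_of_nat_eq_real_of_nat)
  finally show ?thesis .
qed

lemma nn_integral_tower_measure_shift:
  assumes f: "f \<in> borel_measurable (shift_borel M)"
  shows "(\<integral>\<^sup>+x. f (shift x) \<partial>tower_measure) = (\<integral>\<^sup>+x. f x \<partial>tower_measure)"
proof -
  have "(\<integral>\<^sup>+\<omega>. f (phase L \<omega>) \<partial>fair_bits) = (\<integral>\<^sup>+\<omega>. f (phase 0 (\<lambda>i. \<omega> (Suc i))) \<partial>fair_bits)"
    by (simp add: phase_L)
  also have "\<dots> = (\<integral>\<^sup>+\<omega>. f (phase 0 \<omega>) \<partial>distr fair_bits fair_bits (\<lambda>\<omega> i. \<omega> (Suc i)))"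
  proof (rule nn_integral_distr[symmetric])
    show "(\<lambda>\<omega> i. \<omega> (Suc i)) \<in> measurable fair_bits fair_bits"
      unfolding fair_bits_def
      by (rule measurable_PiM_single') (auto simp: measurable_component_singleton)
    show "(\<lambda>\<omega>. f (phase 0 \<omega>)) \<in> borel_measurable (distr fair_bits fair_bits (\<lambda>\<omega> i. \<omega> (Suc i)))"
      using measurable_compose[OF measurable_phase[of 0 "\<lambda>i. i"] f] by simp
  qed
  finally have "(\<integral>\<^sup>+\<omega>. f (phase L \<omega>) \<partial>fair_bits) = (\<integral>\<^sup>+\<omega>. f (phase 0 \<omega>) \<partial>fair_bits)"
    by (simp add: fair_bits_shift)
  from sum_phase_shift[of "\<lambda>j. \<integral>\<^sup>+\<omega>. f (phase j \<omega>) \<partial>fair_bits", OF this]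
  show ?thesis
    using f measurable_compose[OF measurable_shift f] by (simp add: nn_integral_tower_measure shift_phase)
qed

lemma tower_measure_invariant: "tower_measure \<in> invariant_measures M"
proof -
  interpret P: prob_space "measure_pmf (pmf_of_set {..<L}) \<Otimes>\<^sub>M fair_bits"
    by (intro prob_space_pair prob_space_measure_pmf prob_space_fair_bits)
  have ps: "prob_space tower_measure"
    unfolding tower_measure_def by (rule P.prob_space_distr[OF measurable_phase_pair])
  have shift: "shift \<in> measurable tower_measure tower_measure"
    using measurable_shift[of M] by (simp add: measurable_cong_sets[OF sets_tower_measure sets_tower_measure])
  have "distr tower_measure tower_measure shift = tower_measure"
  proof (rule measure_eqI)
    fix C assume "C \<in> sets (distr tower_measure tower_measure shift)"
    hence C: "C \<in> sets (shift_borel M)" by (simp add: sets_tower_measure)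
    have "(\<integral>\<^sup>+x. indicator C x \<partial>distr tower_measure tower_measure shift) = (\<integral>\<^sup>+x. indicator C (shift x) \<partial>tower_measure)"
      using C by (intro nn_integral_distr shift borel_measurable_indicator) (simp add: sets_tower_measure)
    also have "\<dots> = (\<integral>\<^sup>+x. indicator C x \<partial>tower_measure)"
      by (intro nn_integral_tower_measure_shift borel_measurable_indicator C)
    finally show "emeasure (distr tower_measure tower_measure shift) C = emeasure tower_measure C"
      using C by (simp add: sets_tower_measure)
  qed simp
  thus ?thesis using ps by (simp add: invariant_measures_def sets_tower_measure)
qed

text \<open>
  The analogue of \<open>tower_measure\<close> with uniform \<open>n\<close>-periodic bits in place of fair bits.
\<close>

definition periodic_tower :: "nat \<Rightarrow> (nat \<Rightarrow> nat) pmf" where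
  "periodic_tower n = bind_pmf (pmf_of_set {..<L}) (\<lambda>j. map_pmf (phase j) (pmf_of_set (periodic_bits n)))"

lemma nn_integral_periodic_tower:
  "(\<integral>\<^sup>+x. f x \<partial>measure_pmf (periodic_tower n)) =
     inverse (of_nat L) * (\<Sum>j<L. \<integral>\<^sup>+\<omega>. f (phase j \<omega>) \<partial>measure_pmf (pmf_of_set (periodic_bits n)))"
  using L_pos unfolding periodic_tower_def nn_integral_bind_pmf nn_integral_map_pmf
  by (subst nn_integral_pmf_of_set)
     (auto simp: divide_ennreal_def lessThan_empty_iff mult.commute ennreal_of_nat_eq_real_of_nat)

lemma periodic_tower_invariant:
  assumes "0 < n"
  shows "invariant_pmf M (periodic_tower n)"
proof -
  let ?X = "pmf_of_set (periodic_bits n)"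
  have "(\<integral>\<^sup>+x. f (shift x) \<partial>measure_pmf (periodic_tower n)) = (\<integral>\<^sup>+x. f x \<partial>measure_pmf (periodic_tower n))"
    for f :: "(nat \<Rightarrow> nat) \<Rightarrow> ennreal"
  proof -
    have "(\<integral>\<^sup>+\<omega>. f (phase L \<omega>) \<partial>measure_pmf ?X) = (\<integral>\<^sup>+\<omega>. f (phase 0 \<omega>) \<partial>measure_pmf (map_pmf (\<lambda>\<omega> i. \<omega> (Suc i)) ?X))"
      by (simp add: phase_L)
    hence "(\<integral>\<^sup>+\<omega>. f (phase L \<omega>) \<partial>measure_pmf ?X) = (\<integral>\<^sup>+\<omega>. f (phase 0 \<omega>) \<partial>measure_pmf ?X)"
      by (simp only: map_pmf_shift_periodic_bits[OF assms])
    from sum_phase_shift[of "\<lambda>j. \<integral>\<^sup>+\<omega>. f (phase j \<omega>) \<partial>measure_pmf ?X", OF this]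
    show ?thesis by (simp add: nn_integral_periodic_tower shift_phase)
  qed
  note eq = this
  have "emeasure (measure_pmf (map_pmf shift (periodic_tower n))) C
     = emeasure (measure_pmf (periodic_tower n)) C" for C
  proof -
    have "(\<integral>\<^sup>+x. indicator C x \<partial>measure_pmf (map_pmf shift (periodic_tower n))) =
      (\<integral>\<^sup>+x. indicator C x \<partial>measure_pmf (periodic_tower n))"
      by (simp only: nn_integral_map_pmf eq)
    thus ?thesis by (subst (asm) (1 2) nn_integral_indicator) simp_all
  qed
  hence "map_pmf shift (periodic_tower n) = periodic_tower n"
    by (intro pmf_eqI) (simp add: pmf.rep_eq measure_def)
  moreover have "set_pmf (periodic_tower n) \<subseteq> shift_space M"
    unfolding periodic_tower_def using phase_in_shift_space by auto
  ultimately show ?thesis by (simp add: invariant_pmf_def)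
qed

text \<open>
  Fatou's lemma along the periodizations of a random bit sequence, which converge to it
  pointwise and have the law of uniform periodic bits.
\<close>

lemma nn_integral_tower_measure_le:
  fixes f :: "(nat \<Rightarrow> nat) \<Rightarrow> real"
  assumes f: "continuous_on (shift_space M) f"
    and \<Gamma>: "\<And>k. (\<integral>\<^sup>+x. ennreal (f x) \<partial>measure_pmf (periodic_tower (Suc k))) = \<Gamma>"
  shows "(\<integral>\<^sup>+x. ennreal (f x) \<partial>tower_measure) \<le> \<Gamma>"
proof -
  define c where "c = inverse (of_nat L :: ennreal)"
  have c: "c < top" using L_pos by (simp add: c_def less_top[symmetric])
  define H where "H \<omega> = c * (\<Sum>j<L. ennreal (f (phase j \<omega>)))" for \<omega>
  define P where "P k \<omega> = (\<lambda>i. \<omega> (i mod Suc k))" for k and \<omega> :: "nat \<Rightarrow> bool"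
  have f_meas: "(\<lambda>x. ennreal (f x)) \<in> borel_measurable (shift_borel M)"
    using continuous_on_shift_space_measurable[OF f] by simp
  have meas: "(\<lambda>\<omega>. ennreal (f (phase j (\<lambda>i. \<omega> (r i))))) \<in> borel_measurable fair_bits" for j r
    by (rule measurable_compose[OF measurable_phase f_meas])
  have HP_meas: "(\<lambda>\<omega>. H (P k \<omega>)) \<in> borel_measurable fair_bits" for k
    unfolding H_def P_def by (intro borel_measurable_times_ennreal borel_measurable_const borel_measurable_sum meas)
  have lim: "(\<lambda>k. H (P k \<omega>)) \<longlonglongrightarrow> H \<omega>" for \<omega>
  proof -
    have "(\<lambda>k. phase j (P k \<omega>)) \<longlonglongrightarrow> phase j \<omega>" for j
    proof (rule tendsto_fun_if_eventually_eq)
      fix i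
      show "eventually (\<lambda>k. phase j (P k \<omega>) i = phase j \<omega> i) sequentially"
        using eventually_ge_at_top[of "(i + j) div L"]
        by eventually_elim (simp add: phase_def P_def)
    qed
    hence "(\<lambda>k. f (phase j (P k \<omega>))) \<longlonglongrightarrow> f (phase j \<omega>)" for j
      by (intro continuous_on_tendsto_compose[OF f]) (simp_all add: phase_in_shift_space)
    thus ?thesis unfolding H_def by (intro ennreal_tendsto_cmult c tendsto_sum tendsto_ennrealI)
  qed
  have HP: "(\<integral>\<^sup>+\<omega>. H (P k \<omega>) \<partial>fair_bits) = \<Gamma>" for k
  proof -
    have "(\<integral>\<^sup>+\<omega>. H (P k \<omega>) \<partial>fair_bits) = (\<integral>\<^sup>+\<omega>. H \<omega> \<partial>measure_pmf (pmf_of_set (periodic_bits (Suc k))))"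
      unfolding P_def by (rule nn_integral_fair_bits_periodize) simp
    also have "\<dots> = \<Gamma>"
      unfolding \<Gamma>[of k, symmetric] nn_integral_periodic_tower H_def
      by (simp add: nn_integral_cmult nn_integral_sum c_def)
    finally show ?thesis .
  qed
  have "(\<integral>\<^sup>+x. ennreal (f x) \<partial>tower_measure) = (\<integral>\<^sup>+\<omega>. H \<omega> \<partial>fair_bits)"
    unfolding nn_integral_tower_measure[OF f_meas] H_def c_def[symmetric]
    using meas[of _ "\<lambda>i. i"] by (simp add: nn_integral_cmult nn_integral_sum)
  also have "\<dots> = (\<integral>\<^sup>+\<omega>. liminf (\<lambda>k. H (P k \<omega>)) \<partial>fair_bits)"
    by (intro nn_integral_cong) (simp add: lim_imp_Liminf[OF _ lim])
  also have "\<dots> \<le> liminf (\<lambda>k. \<integral>\<^sup>+\<omega>. H (P k \<omega>) \<partial>fair_bits)"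
    by (rule nn_integral_liminf[OF HP_meas])
  also have "\<dots> = \<Gamma>" by (simp add: HP Liminf_const)
  finally show ?thesis .
qed

text \<open>
  The two cells record whether the current letter is \<open>U ! d\<close>.  Once the phase is known, the letter
  at offset \<open>d\<close> of a block tells whether the block is \<open>U\<close> or \<open>V\<close>.
\<close>

definition marker_partition :: "(nat \<Rightarrow> nat) set set" where
  "marker_partition = {{x \<in> shift_space M. x 0 = U ! d}, {x \<in> shift_space M. x 0 \<noteq> U ! d}}"

lemma
  shows finite_marker_partition: "finite marker_partition"
    and partition_on_marker_partition: "partition_on (space tower_measure) marker_partition"
    and marker_partition_sets: "marker_partition \<subseteq> sets tower_measure"
proof -
  show "finite marker_partition" by (simp add: marker_partition_def)
  have "phase d (\<lambda>_. True) \<in> {x \<in> shift_space M. x 0 = U ! d}"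
    "phase d (\<lambda>_. False) \<in> {x \<in> shift_space M. x 0 \<noteq> U ! d}"
    using phase_in_shift_space d differ by (auto simp: phase_def)
  hence "{x \<in> shift_space M. x 0 = U ! d} \<noteq> {}" "{x \<in> shift_space M. x 0 \<noteq> U ! d} \<noteq> {}" by blast+
  thus "partition_on (space tower_measure) marker_partition"
    unfolding space_tower_measure partition_on_def marker_partition_def disjoint_def by auto
  have "(\<lambda>x. x 0) -` A \<inter> space (shift_borel M) \<in> sets (shift_borel M)" for A
    by (rule measurable_sets[OF measurable_shift_borel_coordinate]) simp
  from this[of "{U ! d}"] this[of "- {U ! d}"]
  have "{x \<in> shift_space M. x 0 = U ! d} \<in> sets (shift_borel M)"
    "{x \<in> shift_space M. x 0 \<noteq> U ! d} \<in> sets (shift_borel M)"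
    by (simp_all add: space_shift_borel vimage_def Int_def conj_commute)
  thus "marker_partition \<subseteq> sets tower_measure" by (simp add: marker_partition_def sets_tower_measure)
qed

lemma measurable_shift_tower: "shift \<in> measurable tower_measure tower_measure"
  using measurable_shift[of M] by (simp add: measurable_cong_sets[OF sets_tower_measure sets_tower_measure])

abbreviation marker_join :: "nat \<Rightarrow> (nat \<Rightarrow> nat) set set" where
  "marker_join \<equiv> iterated_join tower_measure shift marker_partition"

lemma marker_join_cell:
  assumes "C \<in> marker_join n" "0 < n"
  obtains s where "C = {x \<in> shift_space M. \<forall>i<n. x i = U ! d \<longleftrightarrow> s i}"
proof -
  obtain l where l: "l \<in> itineraries marker_partition n" "C = join_cell tower_measure shift l"
    using assms iterated_join_eq[OF partition_on_marker_partition, of n shift] by auto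
  have len: "length l = n" using l by (simp add: itineraries_def)
  define A where "A = {x \<in> shift_space M. x 0 = U ! d}"
  define B where "B = {x \<in> shift_space M. x 0 \<noteq> U ! d}"
  have mem: "(shift ^^ i) x \<in> l ! i \<longleftrightarrow> (x i = U ! d \<longleftrightarrow> l ! i = A)"
    if x: "x \<in> shift_space M" and i: "i < n" for x i
  proof -
    have "(shift ^^ i) x \<in> shift_space M" using x by (induction i) (simp_all add: shift_in_shift_space)
    hence "(shift ^^ i) x \<in> A \<longleftrightarrow> x i = U ! d" and "(shift ^^ i) x \<in> B \<longleftrightarrow> x i \<noteq> U ! d"
      by (simp_all add: shift_funpow A_def B_def)
    moreover have "l ! i \<in> set l" using i len by simp
    hence "l ! i \<in> marker_partition" using l(1) by (auto simp: itineraries_def)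
    hence "l ! i = A \<or> l ! i = B" by (simp add: marker_partition_def A_def B_def)
    ultimately show ?thesis by metis
  qed
  have "C = {x \<in> shift_space M. \<forall>i<n. x i = U ! d \<longleftrightarrow> l ! i = A}"
    unfolding l(2) join_cell_def space_tower_measure len using mem by auto
  thus thesis by (rule that)
qed

lemma emeasure_tower_measure:
  assumes "C \<in> sets (shift_borel M)"
  shows "emeasure tower_measure C = inverse (of_nat L) * (\<Sum>j<L. emeasure fair_bits {\<omega>. phase j \<omega> \<in> C})"
proof -
  have "(\<integral>\<^sup>+\<omega>. indicator C (phase j \<omega>) \<partial>fair_bits) = emeasure fair_bits {\<omega>. phase j \<omega> \<in> C}" for j
  proof -
    have "{\<omega>. phase j \<omega> \<in> C} \<in> sets fair_bits"
      using measurable_sets[OF measurable_phase[of j "\<lambda>i. i"] assms] by (simp add: vimage_def)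
    moreover have "indicator C (phase j \<omega>) = (indicator {\<omega>. phase j \<omega> \<in> C} \<omega> :: ennreal)" for \<omega>
      by (simp add: indicator_def)
    ultimately show ?thesis by simp
  qed
  thus ?thesis using nn_integral_tower_measure[of "indicator C"] assms
    by (simp add: sets_tower_measure)
qed

text \<open>
  For each phase, the first \<open>n\<close> letters contain at least \<open>n div L - 1\<close> complete blocks, all of
  whose bits are determined by the cell.
\<close>

lemma marker_join_small:
  assumes C: "C \<in> marker_join n" and n: "0 < n"
  shows "measure tower_measure C \<le> (1 / 2) ^ (n div L - 1)"
proof -
  obtain s where s: "C = {x \<in> shift_space M. \<forall>i<n. x i = U ! d \<longleftrightarrow> s i}"
    using marker_join_cell[OF C n] by blast
  have C_sets: "C \<in> sets (shift_borel M)"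
    using C iterated_join_sets[OF partition_on_marker_partition finite_marker_partition
      marker_partition_sets measurable_shift_tower n] by (auto simp: sets_tower_measure)
  let ?p = "ennreal ((1 / 2) ^ (n div L - 1))"
  have "emeasure fair_bits {\<omega>. phase j \<omega> \<in> C} \<le> ?p" if j: "j < L" for j
  proof -
    let ?J = "{1..<n div L}"
    have "{\<omega>. phase j \<omega> \<in> C} \<subseteq> {\<omega>. \<forall>b\<in>?J. \<omega> b = s (b * L + d - j)}"
    proof (clarify)
      fix \<omega> b assume \<omega>: "phase j \<omega> \<in> C" and b: "b \<in> ?J"
      let ?i = "b * L + d - j"
      have "L \<le> b * L" using b by (cases b) auto
      hence "j \<le> b * L + d" using j by linarith
      hence ij: "?i + j = b * L + d" by simp
      have "Suc b * L \<le> (n div L) * L" using b by (intro mult_le_mono1) auto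
      also have "\<dots> \<le> n" by (rule div_times_less_eq_dividend)
      finally have "?i < n" using d by simp
      hence "phase j \<omega> ?i = U ! d \<longleftrightarrow> s ?i" using \<omega> s by blast
      moreover have "phase j \<omega> ?i = (if \<omega> b then U else V) ! d"
        unfolding phase_def ij using d by simp
      ultimately show "\<omega> b = s ?i" using differ by (cases "\<omega> b") auto
    qed
    hence "emeasure fair_bits {\<omega>. phase j \<omega> \<in> C} \<le> emeasure fair_bits {\<omega>. \<forall>b\<in>?J. \<omega> b = s (b * L + d - j)}"
      by (intro emeasure_mono sets_fair_bits_cylinder) simp_all
    also have "\<dots> = ?p" by (subst emeasure_fair_bits_cylinder) simp_all
    finally show ?thesis .
  qed
  hence "(\<Sum>j<L. emeasure fair_bits {\<omega>. phase j \<omega> \<in> C}) \<le> (\<Sum>j<L. ?p)" by (intro sum_mono) simp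
  hence "emeasure tower_measure C \<le> inverse (of_nat L) * (of_nat L * ?p)"
    unfolding emeasure_tower_measure[OF C_sets] by (intro mult_left_mono) simp_all
  also have "\<dots> = (of_nat L * inverse (of_nat L)) * ?p" by (simp add: ac_simps)
  also have "of_nat L * inverse (of_nat L :: ennreal) = 1"
    using L_pos by (intro ennreal_divide_self[unfolded divide_ennreal_def])
      (simp_all add: ennreal_of_nat_eq_real_of_nat)
  finally have "emeasure tower_measure C \<le> ?p" by simp
  thus ?thesis by (simp add: measure_def enn2real_leI)
qed

text \<open>
  The first \<open>n\<close> letters depend only on the phase and on the first \<open>n div L + 2\<close> bits.
\<close>

lemma card_marker_join:
  assumes n: "0 < n"
  shows "card {C \<in> marker_join n. measure tower_measure C \<noteq> 0} \<le> L * 2 ^ (n div L + 2)"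
proof -
  let ?m = "n div L + 2"
  let ?W = "{..<L} \<times> {bs :: bool list. set bs \<subseteq> UNIV \<and> length bs = ?m}"
  have disj: "disjoint (marker_join n)"
    by (rule disjoint_iterated_join[OF partition_on_marker_partition finite_marker_partition
      marker_partition_sets measurable_shift_tower n])
  have J_sets: "marker_join n \<subseteq> sets (shift_borel M)"
    using iterated_join_sets[OF partition_on_marker_partition finite_marker_partition
      marker_partition_sets measurable_shift_tower n] by (simp add: sets_tower_measure)
  have finW: "finite ?W" and cardW: "card ?W = L * 2 ^ ?m"
    using finite_lists_length_eq[of "UNIV :: bool set" ?m] card_lists_length_eq[of "UNIV :: bool set" ?m]
    by (simp_all add: card_cartesian_product)
  define cell where "cell z = (THE C. C \<in> marker_join n \<and> phase (fst z) (\<lambda>i. snd z ! i) \<in> C)" for z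
  have "C \<in> cell ` ?W" if C: "C \<in> marker_join n" "measure tower_measure C \<noteq> 0" for C
  proof -
    obtain s where s: "C = {x \<in> shift_space M. \<forall>i<n. x i = U ! d \<longleftrightarrow> s i}"
      using marker_join_cell[OF C(1) n] by blast
    have "\<exists>j<L. \<exists>\<omega>. phase j \<omega> \<in> C"
    proof (rule ccontr)
      assume "\<not> ?thesis"
      hence "{\<omega>. phase j \<omega> \<in> C} = {}" if "j < L" for j using that by blast
      hence "emeasure tower_measure C = 0"
        using C(1) J_sets by (subst emeasure_tower_measure) (auto simp: subset_iff)
      thus False using C(2) by (simp add: measure_def)
    qed
    then obtain j \<omega> where j: "j < L" and \<omega>: "phase j \<omega> \<in> C" by blast
    let ?bs = "map \<omega> [0..<?m]"
    have "phase j (\<lambda>i. ?bs ! i) i = phase j \<omega> i" if "i < n" for i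
    proof -
      have "(i + j) div L \<le> (n + L) div L" using that j by (intro div_le_mono) simp
      also have "\<dots> = n div L + 1" using L_pos by simp
      finally have "(i + j) div L < ?m" by simp
      thus ?thesis by (simp add: phase_def del: upt_Suc)
    qed
    hence "phase j (\<lambda>i. ?bs ! i) \<in> C" using \<omega> phase_in_shift_space unfolding s by auto
    hence "cell (j, ?bs) = C"
      unfolding cell_def using C(1) disjointD[OF disj]
      by (intro the_equality) (simp_all del: upt_Suc, blast)
    moreover have "(j, ?bs) \<in> ?W" using j by simp
    ultimately show ?thesis by blast
  qed
  hence "card {C \<in> marker_join n. measure tower_measure C \<noteq> 0} \<le> card (cell ` ?W)"
    using finW by (intro card_mono) auto
  also have "\<dots> \<le> card ?W" by (rule card_image_le[OF finW])
  finally show ?thesis unfolding cardW .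
qed

text \<open>
  The two preceding bounds squeeze \<open>H n / n\<close> for the marker partition to the limit
  \<open>ln 2 / L\<close>.
\<close>

theorem measure_entropy_tower_pos: "0 < measure_entropy tower_measure shift"
proof -
  interpret prob_space tower_measure
    using tower_measure_invariant by (simp add: invariant_measures_def)
  have one: "(\<Sum>C\<in>marker_join n. measure tower_measure C) = 1" if n: "0 < n" for n
  proof -
    note J = partition_on_marker_partition finite_marker_partition marker_partition_sets measurable_shift_tower n
    have "(\<Sum>C\<in>marker_join n. prob C) = prob (\<Union> (marker_join n))"
      by (intro sum_measure_disjoint finite_iterated_join[OF J] iterated_join_sets[OF J] disjoint_iterated_join[OF J])
    also have "\<dots> = 1" by (simp add: Union_iterated_join[OF J] prob_space)
    finally show ?thesis .
  qed
  let ?H = "\<lambda>n. partition_entropy tower_measure (marker_join n)"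
  have divL: "real n / real L - 1 \<le> real (n div L)" "real (n div L) \<le> real n / real L" for n
    using floor_divide_of_nat_eq[of n L, where 'a = real] by linarith+
  have lower: "ln 2 / real L - 2 * ln 2 / real n \<le> ?H n / real n" if n: "0 < n" for n
  proof -
    have "- ln ((1 / 2) ^ (n div L - 1)) \<le> ?H n"
      by (rule partition_entropy_ge[OF one[OF n]]) (simp, rule marker_join_small[OF _ n])
    hence "real (n div L - 1) * ln 2 \<le> ?H n" by (simp add: ln_realpow ln_div)
    moreover have "(real n / real L - 2) * ln 2 \<le> real (n div L - 1) * ln 2"
      using divL(1)[of n] by (intro mult_right_mono) (linarith, simp)
    ultimately have "(real n / real L - 2) * ln 2 / real n \<le> ?H n / real n"
      using n by (intro divide_right_mono) (linarith, simp)
    thus ?thesis using n by (simp add: field_simps)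
  qed
  have ln_pow: "ln (real (L * 2 ^ m)) = ln (real L) + real m * ln 2" for m
    using L_pos by (simp add: ln_mult ln_realpow)
  have upper: "?H n / real n \<le> ln 2 / real L + (ln (real L) + 2 * ln 2) / real n" if n: "0 < n" for n
  proof -
    note J = partition_on_marker_partition finite_marker_partition marker_partition_sets measurable_shift_tower n
    have "?H n \<le> ln (real (L * 2 ^ (n div L + 2)))"
      using L_pos by (intro partition_entropy_le finite_iterated_join[OF J] one[OF n] card_marker_join n) simp
    also have "\<dots> = ln (real L) + real (n div L + 2) * ln 2"
      by (rule ln_pow)
    also have "\<dots> \<le> ln (real L) + (real n / real L + 2) * ln 2"
      using divL(2)[of n] by (intro add_left_mono mult_right_mono) simp_all
    finally have "?H n / real n \<le> (ln (real L) + (real n / real L + 2) * ln 2) / real n"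
      using n by (intro divide_right_mono) simp_all
    thus ?thesis using n by (simp add: field_simps)
  qed
  have c: "(\<lambda>n. c / real n) \<longlonglongrightarrow> 0" for c
    by (rule lim_const_over_n)
  have "(\<lambda>n. ?H n / real n) \<longlonglongrightarrow> ln 2 / real L"
  proof (rule tendsto_sandwich)
    show "eventually (\<lambda>n. ln 2 / real L - 2 * ln 2 / real n \<le> ?H n / real n) sequentially"
      using eventually_gt_at_top[of 0] by eventually_elim (rule lower)
    show "eventually (\<lambda>n. ?H n / real n \<le> ln 2 / real L + (ln (real L) + 2 * ln 2) / real n) sequentially"
      using eventually_gt_at_top[of 0] by eventually_elim (rule upper)
    show "(\<lambda>n. ln 2 / real L - 2 * ln 2 / real n) \<longlonglongrightarrow> ln 2 / real L"
      using tendsto_diff[OF tendsto_const c] by (simp only: diff_zero)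
    show "(\<lambda>n. ln 2 / real L + (ln (real L) + 2 * ln 2) / real n) \<longlonglongrightarrow> ln 2 / real L"
      using tendsto_add[OF tendsto_const c] by (simp only: add_0_right)
  qed
  hence "ereal (ln 2 / real L) \<le> measure_entropy tower_measure shift"
    by (rule measure_entropy_ge[OF finite_marker_partition partition_on_marker_partition marker_partition_sets])
  moreover have "0 < ereal (ln 2 / real L)" using L_pos by simp
  ultimately show ?thesis by (rule order_less_le_trans[rotated])
qed

end

section \<open>Weak* density\<close>

text \<open>
  Convergence of the integrals of bounded continuous functions is eventual membership in the
  subbasic open sets, which passes to finite intersections and unions.
\<close>

lemma in_weak_star_closureI:
  assumes \<mu>: "\<mu> \<in> invariant_measures M"
    and m: "\<And>n :: nat. m n \<in> S" and S: "S \<subseteq> invariant_measures M"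
    and lim: "\<And>f :: (nat \<Rightarrow> nat) \<Rightarrow> real. continuous_on (shift_space M) f \<Longrightarrow> bounded (f ` shift_space M) \<Longrightarrow>
      (\<lambda>n. \<integral>x. f x \<partial>m n) \<longlonglongrightarrow> (\<integral>x. f x \<partial>\<mu>)"
  shows "\<mu> \<in> weak_star_topology M closure_of S"
proof -
  let ?B = "{{\<mu> \<in> invariant_measures M. (\<integral>x. f x \<partial>\<mu>) \<in> U} | (f :: (nat \<Rightarrow> nat) \<Rightarrow> real) U.
        continuous_on (shift_space M) f \<and> bounded (f ` shift_space M) \<and> open U}"
  have "\<mu> \<in> T \<longrightarrow> eventually (\<lambda>n. m n \<in> T) sequentially" if "generate_topology_on ?B T" for T
    using that
  proof induction
    case (Int a b)
    thus ?case by (auto intro: eventually_conj)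
  next
    case (UN K)
    show ?case
    proof
      assume "\<mu> \<in> \<Union>K"
      then obtain k where "k \<in> K" "\<mu> \<in> k" by auto
      with UN.IH[of k] have "eventually (\<lambda>n. m n \<in> k) sequentially" by simp
      thus "eventually (\<lambda>n. m n \<in> \<Union>K) sequentially"
        by eventually_elim (use \<open>k \<in> K\<close> in auto)
    qed
  next
    case (Basis T)
    thus ?case
    proof (elim CollectE exE conjE, intro impI)
      fix f :: "(nat \<Rightarrow> nat) \<Rightarrow> real" and U
      assume T: "T = {\<mu> \<in> invariant_measures M. (\<integral>x. f x \<partial>\<mu>) \<in> U}"
        and f: "continuous_on (shift_space M) f" "bounded (f ` shift_space M)" and U: "open U"
        and "\<mu> \<in> T"
      hence "eventually (\<lambda>n. (\<integral>x. f x \<partial>m n) \<in> U) sequentially"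
        using topological_tendstoD[OF lim[OF f] U] by simp
      thus "eventually (\<lambda>n. m n \<in> T) sequentially"
        by eventually_elim (use m S in \<open>auto simp: T\<close>)
    qed
  qed simp
  hence ev: "eventually (\<lambda>n. m n \<in> T) sequentially" if "openin (weak_star_topology M) T" "\<mu> \<in> T" for T
    using that unfolding weak_star_topology_def openin_topology_generated_by_iff by simp
  have "\<exists>y. y \<in> S \<and> y \<in> T" if "openin (weak_star_topology M) T" "\<mu> \<in> T" for T
  proof -
    have "\<exists>n. m n \<in> T" using ev[OF that] by (rule eventually_happens'[OF sequentially_bot])
    then obtain n where "m n \<in> T" ..
    thus ?thesis using m[of n] by blast
  qed
  moreover have "\<mu> \<in> topspace (weak_star_topology M)"
  proof -
    have "{\<mu> \<in> invariant_measures M. (\<integral>x. (0::real) \<partial>\<mu>) \<in> UNIV} \<in> ?B"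
      by (intro CollectI exI[of _ "\<lambda>_. 0"] exI[of _ UNIV]) (auto simp: bounded_iff)
    thus ?thesis
      unfolding weak_star_topology_def topology_generated_by_topspace
      by (rule UnionI) (simp add: \<mu>)
  qed
  ultimately show ?thesis by (simp add: in_closure_of)
qed

lemma weak_star_closure_subset:
  "weak_star_topology M closure_of S \<subseteq> invariant_measures M"
proof -
  have "topspace (weak_star_topology M) \<subseteq> invariant_measures M"
    unfolding weak_star_topology_def topology_generated_by_topspace by auto
  with closure_of_subset_topspace show ?thesis by (rule order_trans)
qed

text \<open>
  The mixture of \<open>q\<close> with weight \<open>\<epsilon>\<close> and \<open>p\<close> with weight \<open>1 - \<epsilon>\<close>.
\<close>

definition mixture_pmf :: "real \<Rightarrow> 'a pmf \<Rightarrow> 'a pmf \<Rightarrow> 'a pmf" where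
  "mixture_pmf \<epsilon> q p = bind_pmf (bernoulli_pmf \<epsilon>) (\<lambda>b. if b then q else p)"

lemma expectation_mixture_pmf:
  fixes g :: "'a \<Rightarrow> real"
  assumes \<epsilon>: "0 < \<epsilon>" "\<epsilon> < 1" and bound: "\<And>x. x \<in> set_pmf q \<union> set_pmf p \<Longrightarrow> \<bar>g x\<bar> \<le> B"
  shows "measure_pmf.expectation (mixture_pmf \<epsilon> q p) g =
    \<epsilon> * measure_pmf.expectation q g + (1 - \<epsilon>) * measure_pmf.expectation p g"
proof -
  let ?m = "mixture_pmf \<epsilon> q p"
  have set_m: "set_pmf ?m = set_pmf q \<union> set_pmf p"
    using \<epsilon> by (auto simp: mixture_pmf_def split: if_splits)
  \<comment> \<open>Adding \<open>B\<close> makes the integrand nonnegative, so that no integrability of iterated integrals is needed.\<close>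
  have shifted: "(\<integral>\<^sup>+x. ennreal (g x + B) \<partial>measure_pmf r) = ennreal (measure_pmf.expectation r g + B)"
    and nonneg: "0 \<le> measure_pmf.expectation r g + B"
    if r: "set_pmf r \<subseteq> set_pmf q \<union> set_pmf p" for r
  proof -
    have b: "AE x in measure_pmf r. \<bar>g x\<bar> \<le> B" using r bound by (auto simp: AE_measure_pmf_iff)
    have int: "integrable (measure_pmf r) g"
      by (rule measure_pmf.integrable_const_bound[where B = B]) (use b in simp_all)
    have nn: "AE x in measure_pmf r. 0 \<le> g x + B" using b by eventually_elim linarith
    have E: "(\<integral>x. g x + B \<partial>measure_pmf r) = measure_pmf.expectation r g + B"
      using int by simp
    show "(\<integral>\<^sup>+x. ennreal (g x + B) \<partial>measure_pmf r) = ennreal (measure_pmf.expectation r g + B)"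
      unfolding E[symmetric] using int nn by (intro nn_integral_eq_integral) simp_all
    show "0 \<le> measure_pmf.expectation r g + B"
      unfolding E[symmetric] using nn by (rule integral_nonneg_AE)
  qed
  have "ennreal (measure_pmf.expectation ?m g + B) = (\<integral>\<^sup>+x. ennreal (g x + B) \<partial>measure_pmf ?m)"
    by (rule shifted[symmetric]) (simp add: set_m)
  also have "\<dots> = ennreal (measure_pmf.expectation q g + B) * ennreal \<epsilon>
      + ennreal (measure_pmf.expectation p g + B) * ennreal (1 - \<epsilon>)"
    using \<epsilon> by (simp add: mixture_pmf_def shifted)
  also have "\<dots> = ennreal ((measure_pmf.expectation q g + B) * \<epsilon> + (measure_pmf.expectation p g + B) * (1 - \<epsilon>))"
    using \<epsilon> nonneg[of q] nonneg[of p] by (simp add: ennreal_mult ennreal_plus)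
  finally have "measure_pmf.expectation ?m g + B =
     (measure_pmf.expectation q g + B) * \<epsilon> + (measure_pmf.expectation p g + B) * (1 - \<epsilon>)"
    using \<epsilon> nonneg[of q] nonneg[of p] nonneg[of ?m] by (subst (asm) ennreal_inj) (simp_all add: set_m)
  thus ?thesis by (simp add: algebra_simps)
qed

theorem theorem7p6:
  fixes M :: "nat \<Rightarrow> nat \<Rightarrow> nat"
  assumes "transition_matrix M" and "transitive_shift M"
  shows "weak_star_topology M closure_of
           {\<mu> \<in> invariant_measures M.
              \<not> (\<exists>\<phi> :: (nat \<Rightarrow> nat) \<Rightarrow> real.
                   continuous_on (shift_space M) \<phi> \<and> bdd_above (\<phi> ` shift_space M) \<and>
                   equilibrium_measure M \<phi> \<mu>)}
         = invariant_measures M"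
    (is "_ closure_of ?S = _")
proof (rule antisym[OF weak_star_closure_subset], rule subsetI)
  fix \<mu> assume \<mu>: "\<mu> \<in> invariant_measures M"
  obtain L d U V where "horseshoe M 0 L d U V"
    using transitive_imp_horseshoe[OF assms(2)] by blast
  then interpret horseshoe M 0 L d U V .
  have "\<exists>p. invariant_pmf M p \<and> distr (atomic_measure M p) (count_space UNIV) (initial_block (Suc N))
      = distr \<mu> (count_space UNIV) (initial_block (Suc N))" for N
    using exists_invariant_pmf_with_block_law[OF \<mu>, of "Suc N"] by blast
  then obtain p where p: "\<And>N. invariant_pmf M (p N)"
    and block: "\<And>N. distr (atomic_measure M (p N)) (count_space UNIV) (initial_block (Suc N))
      = distr \<mu> (count_space UNIV) (initial_block (Suc N))"
    by metis
  define q where "q = bind_pmf (geometric_pmf (1 / 2)) (\<lambda>k. periodic_tower (Suc k))"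
  have q: "invariant_pmf M q"
    unfolding q_def by (intro invariant_pmf_bind periodic_tower_invariant) simp
  define \<epsilon> where "\<epsilon> n = inverse (real (Suc (Suc n)))" for n :: nat
  have \<epsilon>: "0 < \<epsilon> n" "\<epsilon> n < 1" for n by (simp_all add: \<epsilon>_def inverse_less_1_iff)
  have \<epsilon>_lim: "\<epsilon> \<longlonglongrightarrow> 0" unfolding \<epsilon>_def[abs_def] by (rule LIMSEQ_Suc[OF LIMSEQ_inverse_real_of_nat])
  define r where "r n = mixture_pmf (\<epsilon> n) q (p n)" for n
  have r: "invariant_pmf M (r n)" for n
    unfolding r_def mixture_pmf_def by (rule invariant_pmf_bind) (use p q in auto)
  have no_equilibrium: "\<not> equilibrium_measure M \<phi> (atomic_measure M (r n))"
    if "continuous_on (shift_space M) \<phi>" "bdd_above (\<phi> ` shift_space M)" for \<phi> n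
    unfolding r_def mixture_pmf_def q_def
  proof (rule atomic_mixture_not_equilibrium)
    show "set_pmf (geometric_pmf (1 / 2)) = UNIV" by (rule set_pmf_geometric) simp_all
  qed (use p \<epsilon> that tower_measure_invariant measure_entropy_tower_pos periodic_tower_invariant
         nn_integral_tower_measure_le in auto)
  have S: "atomic_measure M (r n) \<in> ?S" for n
  proof (intro CollectI conjI notI atomic_measure_invariant r)
    assume "\<exists>\<phi> :: (nat \<Rightarrow> nat) \<Rightarrow> real. continuous_on (shift_space M) \<phi> \<and>
      bdd_above (\<phi> ` shift_space M) \<and> equilibrium_measure M \<phi> (atomic_measure M (r n))"
    thus False by (elim exE conjE) (rule notE[OF no_equilibrium])
  qed
  show "\<mu> \<in> weak_star_topology M closure_of ?S"
  proof (rule in_weak_star_closureI[OF \<mu>, where m = "\<lambda>n. atomic_measure M (r n)"])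
    fix f :: "(nat \<Rightarrow> nat) \<Rightarrow> real"
    assume f: "continuous_on (shift_space M) f" "bounded (f ` shift_space M)"
    obtain B where B: "\<And>x. x \<in> shift_space M \<Longrightarrow> \<bar>f x\<bar> \<le> B" using f(2) by (auto simp: bounded_iff)
    have f_meas: "f \<in> borel_measurable (shift_borel M)" using f(1) by (rule continuous_on_shift_space_measurable)
    have supp: "set_pmf s \<subseteq> shift_space M" if "invariant_pmf M s" for s
      using that by (simp add: invariant_pmf_def)
    \<comment> \<open>\<open>p N\<close> matches blocks of length \<open>Suc N\<close>; \<open>\<mu>\<close> itself serves for length 0.\<close>
    define m where "m = case_nat \<mu> (\<lambda>N. atomic_measure M (p N))"
    have inv: "m N \<in> invariant_measures M" for N
      by (cases N) (simp_all add: m_def \<mu> atomic_measure_invariant p)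
    have "(\<lambda>N. \<integral>x. f x \<partial>m N) \<longlonglongrightarrow> (\<integral>x. f x \<partial>\<mu>)"
    proof (rule block_laws_imp_weak_convergence[OF _ _ _ _ _ f])
      show "distr (m N) (count_space UNIV) (initial_block N) = distr \<mu> (count_space UNIV) (initial_block N)" for N
        by (cases N) (simp_all add: m_def block)
    qed (use \<mu> inv in \<open>auto simp: invariant_measures_def\<close>)
    hence "(\<lambda>N. \<integral>x. f x \<partial>m (Suc N)) \<longlonglongrightarrow> (\<integral>x. f x \<partial>\<mu>)" by (rule LIMSEQ_Suc)
    hence lim: "(\<lambda>N. measure_pmf.expectation (p N) f) \<longlonglongrightarrow> (\<integral>x. f x \<partial>\<mu>)"
      by (simp add: m_def integral_atomic_measure[OF supp[OF p] f_meas])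
    have "(\<lambda>n. \<epsilon> n * measure_pmf.expectation q f + (1 - \<epsilon> n) * measure_pmf.expectation (p n) f)
        \<longlonglongrightarrow> 0 * measure_pmf.expectation q f + (1 - 0) * (\<integral>x. f x \<partial>\<mu>)"
      by (intro tendsto_intros \<epsilon>_lim lim)
    moreover have "(\<integral>x. f x \<partial>atomic_measure M (r n)) =
        \<epsilon> n * measure_pmf.expectation q f + (1 - \<epsilon> n) * measure_pmf.expectation (p n) f" for n
      unfolding integral_atomic_measure[OF supp[OF r] f_meas] unfolding r_def
      using supp[OF q] supp[OF p] by (intro expectation_mixture_pmf[where B = B] \<epsilon> B) blast
    ultimately show "(\<lambda>n. \<integral>x. f x \<partial>atomic_measure M (r n)) \<longlonglongrightarrow> (\<integral>x. f x \<partial>\<mu>)" by simp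
  qed (use S in auto)
qed

end
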